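(* Assume (NON-INC) and (POS). Let $\tau^*\in[0,T]$ denote a best switching time, that is, a $\tau$ attaining $\inf_{\tau\in[0,T]}\mathcal{C}(x,\tau)$. Let $\tau^{ub}$ be the smallest $\tau$ value satisfying $$\widetilde c_2(T)\ \ge\ \mathbb{P}\{N_\tau\le x-1\}\,[c_2(\tau)+c_4].$$ If the inequality does not hold for any $\tau\in[0,T]$, then let $\tau^{ub}=T$. Then $\tau^*\le\tau^{ub}$.
   Context: $T\in[0,\infty)$; $x\in\mathbb{Z}_+=\{0,1,\dots\}$ is the inventory level; $N=(N_t)_{t\in[0,T]}$ is a non-homogeneous Poisson process with intensity $\lambda:[0,T]\to\mathbb{R}_+$, which is right-continuous with left limits, piecewise smooth (differentiable except at finitely many points), and non-increasing. Constants $c_1\in\mathbb{R}_+$, $c_4\in\mathbb{R}$, $\delta\in[0,1]$; functions $c_2,c_3:[0,T]\to\mathbb{R}_+$; $\widetilde c_2(u):=c_2(u)-c_3(u)$. Let $\sigma_x=\inf\{u>0:N_u\ge x\}$, $a\wedge b=\min\{a,b\}$, $(a)^+=\max\{0,a\}$. For $\tau\in[0,T]$ (a deterministic "switching time"), $$\mathcal{C}(x,\tau)=c_1\mathbb{E}\Big[\int_0^\tau e^{-\delta u}(x-N_u)^+du\Big]+\mathbb{E}\Big[\int_{\tau\wedge\sigma_x}^{\tau}e^{-\delta u}c_2(u)\,dN_u\Big]+\mathbb{E}\Big[\int_\tau^Te^{-\delta u}c_3(u)\,dN_u\Big]+c_4e^{-\delta\tau}\mathbb{E}[(x-N_\tau)^+].$$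 (NON-INC): the functions $c_3$ and $\widetilde c_2$ are right-continuous with left limits, piecewise smooth (differentiable except at finitely many points), and non-increasing. (POS): the functions $c_3$ and $\widetilde c_2$ are non-negative, and $c_4\ge0$, $c_1-\delta c_4\ge0$.
   Formalization: With ties the claim can fail (all costs zero: τ^ub=0, yet τ*=T is best). Proved instead: the smallest best switching time exists and is ≤ τ^ub; any best τ* is ≤ τ^ub unless every time in [τ^ub,τ*] is also best. Conditions excluding ties are not treated. *)

theory Defs
  imports "HOL-Probability.Probability"
begin

definition regular_nonincreasing :: "real \<Rightarrow> (real \<Rightarrow> real) \<Rightarrow> bool" where
  "regular_nonincreasing T f \<longleftrightarrow>
     (\<forall>t\<in>{0..<T}. continuous (at_right t) f) \<and>
     (\<forall>t\<in>{0<..T}. \<exists>l. (f \<longlongrightarrow> l) (at_left t)) \<and>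
     (\<exists>S. finite S \<and> (\<forall>t\<in>{0..T} - S. f differentiable (at t within {0..T}))) \<and>
     antimono_on {0..T} f"

text \<open>All conditions concern times in \<open>[0, T]\<close> only; the values of \<open>N\<close> and \<open>lam\<close> elsewhere
  are irrelevant.  When the mean of an increment is 0, the Poisson weights below are those of the
  point mass at 0, since \<open>0 ^ 0 = 1\<close>.\<close>

definition nonhom_poisson_process ::
    "'a measure \<Rightarrow> real \<Rightarrow> (real \<Rightarrow> real) \<Rightarrow> (real \<Rightarrow> 'a \<Rightarrow> nat) \<Rightarrow> bool" where
  "nonhom_poisson_process M T lam N \<longleftrightarrow>
     prob_space M \<and>
     (\<forall>t\<in>{0..T}. N t \<in> measurable M (count_space UNIV)) \<and>
     (\<forall>\<omega>\<in>space M. N 0 \<omega> = 0 \<and> mono_on {0..T} (\<lambda>t. N t \<omega>) \<and>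
        (\<forall>t\<in>{0..<T}. continuous (at_right t) (\<lambda>s. real (N s \<omega>)))) \<and>
     (\<forall>n (t :: nat \<Rightarrow> real). 0 \<le> t 0 \<longrightarrow> (\<forall>i<n. t i \<le> t (Suc i)) \<longrightarrow> t n \<le> T \<longrightarrow>
        prob_space.indep_vars M (\<lambda>_. count_space UNIV)
          (\<lambda>i \<omega>. N (t (Suc i)) \<omega> - N (t i) \<omega>) {..<n}) \<and>
     (\<forall>s t. 0 \<le> s \<longrightarrow> s \<le> t \<longrightarrow> t \<le> T \<longrightarrow>
        (\<forall>k. measure M {\<omega> \<in> space M. N t \<omega> - N s \<omega> = k} =
          (LBINT u:{s..t}. lam u) ^ k / fact k * exp (- (LBINT u:{s..t}. lam u))))"

text \<open>The Lebesgue--Stieltjes measure \<open>dN\<^sub>u(\<omega>)\<close> of the path on \<open>[0, T]\<close>.  The path is extended to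
  a right-continuous non-decreasing function on the whole line by freezing it outside \<open>[0, T]\<close>,
  so there is no mass outside \<open>(0, T]\<close>.\<close>

definition path_measure :: "real \<Rightarrow> (real \<Rightarrow> 'a \<Rightarrow> nat) \<Rightarrow> 'a \<Rightarrow> real measure" where
  "path_measure T N \<omega> = interval_measure (\<lambda>u. real (N (max 0 (min T u)) \<omega>))"

text \<open>The depletion time \<open>\<sigma>\<^sub>x\<close>; it is \<open>\<infinity>\<close> if the level \<open>x\<close> is not reached on \<open>(0, T]\<close>.\<close>

definition depletion_time :: "real \<Rightarrow> (real \<Rightarrow> 'a \<Rightarrow> nat) \<Rightarrow> nat \<Rightarrow> 'a \<Rightarrow> ereal" where
  "depletion_time T N x \<omega> = Inf (ereal ` {u. 0 < u \<and> u \<le> T \<and> x \<le> N u \<omega>})"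

definition min_depletion :: "real \<Rightarrow> (real \<Rightarrow> 'a \<Rightarrow> nat) \<Rightarrow> nat \<Rightarrow> real \<Rightarrow> 'a \<Rightarrow> real" where
  "min_depletion T N x \<tau> \<omega> = real_of_ereal (min (ereal \<tau>) (depletion_time T N x \<omega>))"

text \<open>The integrals against \<open>dN\<^sub>u\<close> from \<open>a\<close> to \<open>b\<close> are over \<open>(a, b]\<close>: the demand
  arriving at \<open>\<sigma>\<^sub>x\<close> takes the last unit in stock and is not charged \<open>c\<^sub>2\<close>.\<close>

definition switching_cost ::
    "'a measure \<Rightarrow> real \<Rightarrow> (real \<Rightarrow> 'a \<Rightarrow> nat) \<Rightarrow> real \<Rightarrow> real \<Rightarrow> (real \<Rightarrow> real) \<Rightarrow> (real \<Rightarrow> real) \<Rightarrow> real \<Rightarrow>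
     nat \<Rightarrow> real \<Rightarrow> real" where
  "switching_cost M T N \<delta> c1 c2 c3 c4 x \<tau> =
     c1 * (LINT \<omega>|M. (LBINT u:{0..\<tau>}. exp (- \<delta> * u) * max 0 (real x - real (N u \<omega>))))
     + (LINT \<omega>|M. (LINT u:{min_depletion T N x \<tau> \<omega><..\<tau>}|path_measure T N \<omega>. exp (- \<delta> * u) * c2 u))
     + (LINT \<omega>|M. (LINT u:{\<tau><..T}|path_measure T N \<omega>. exp (- \<delta> * u) * c3 u))
     + c4 * exp (- \<delta> * \<tau>) * (LINT \<omega>|M. max 0 (real x - real (N \<tau> \<omega>)))"

definition best_switching_times :: "real \<Rightarrow> (real \<Rightarrow> real) \<Rightarrow> real set" where
  "best_switching_times T C = {\<tau> \<in> {0..T}. C \<tau> = (INF s\<in>{0..T}. C s)}"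

text \<open>The comparison \<open>N\<^sub>\<tau> \<le> x - 1\<close> is made in the integers, so that the event is empty for
  \<open>x = 0\<close>.\<close>

definition ub_condition ::
    "'a measure \<Rightarrow> real \<Rightarrow> (real \<Rightarrow> 'a \<Rightarrow> nat) \<Rightarrow> (real \<Rightarrow> real) \<Rightarrow> (real \<Rightarrow> real) \<Rightarrow> real \<Rightarrow>
     nat \<Rightarrow> real \<Rightarrow> bool" where
  "ub_condition M T N c2 c3 c4 x \<tau> \<longleftrightarrow>
     c2 T - c3 T \<ge> measure M {\<omega> \<in> space M. int (N \<tau> \<omega>) \<le> int x - 1} * (c2 \<tau> + c4)"

definition tau_ub ::
    "'a measure \<Rightarrow> real \<Rightarrow> (real \<Rightarrow> 'a \<Rightarrow> nat) \<Rightarrow> (real \<Rightarrow> real) \<Rightarrow> (real \<Rightarrow> real) \<Rightarrow> real \<Rightarrow>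
     nat \<Rightarrow> real" where
  "tau_ub M T N c2 c3 c4 x =
     (if \<exists>\<tau>\<in>{0..T}. ub_condition M T N c2 c3 c4 x \<tau>
      then (LEAST \<tau>. \<tau> \<in> {0..T} \<and> ub_condition M T N c2 c3 c4 x \<tau>)
      else T)"

end

(*
  For s <= t the increment of the cost between the switching times s and t is bounded pathwise
  in terms of t - s, the demand D = N_t - N_s and the event {x <= N_s}.  Since D is
  independent of N_s with mean at most lam(0) (t - s), taking expectations shows that the cost
  is Lipschitz in the switching time.  If moreover the inequality defining tau_ub holds at s, the
  increment is at least -K (t - s) ((t - s) + f(s) - f(t)), where f(u) = exp(-delta u) c_2(u) is
  non-increasing; on a partition of mesh h the f-differences telescope, so that these errors add
  up to O(h).  The inequality persists after tau_ub because its right-hand side is non-increasing,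
  hence the cost is non-decreasing on [tau_ub, T].
*)
theory Submission
  imports Defs
begin

text \<open>The inequality defining \<open>tau_ub\<close> is a first-order balance per expected
  demand. Postponing the switch a little charges \<open>c2\<close> if the stock is empty, saves
  \<open>c3\<close> in any case, and saves the terminal cost \<open>c4\<close> if a unit is sold.
  With P the probability of positive stock this makes (1 - P) c2 - c3 - P c4 = (c2 - c3) - P (c2 +
  c4), and \<open>c2 T - c3 T\<close> is the least value of \<open>c2 - c3\<close>. The holding cost
  enters only to offset the discounting of the terminal cost, which is what
  \<open>c1 - \<delta> * c4 \<ge> 0\<close> permits. The obstacle is regularity: \<open>c2\<close>
  may jump, so the cost need not be differentiable in the switching time, and finite increments take
  the place of a derivative. Monotonicity after \<open>tau_ub\<close> is not strict, so later best
  times cannot be excluded: if all costs vanish, every time is best although \<open>tau_ub\<close>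
  is 0. Hence the conclusion bounds the least best time and says that a later one can only end a
  stretch of best times beginning at \<open>tau_ub\<close>. Continuity of the cost makes the infimum
  attained.\<close>

lemma borel_measurable_antimono_on:
  fixes f :: "real \<Rightarrow> real"
  assumes "antimono_on A f" "A \<in> sets borel"
  shows "set_borel_measurable borel A f"
proof -
  have "mono_on A (\<lambda>u. - f u)"
    using assms(1) by (auto simp: monotone_on_def)
  then have "(\<lambda>u. - f u) \<in> borel_measurable (restrict_space borel A)"
    by (rule borel_measurable_mono_on_fnc)
  then have "(\<lambda>u. - (- f u)) \<in> borel_measurable (restrict_space borel A)"
    by (rule borel_measurable_uminus)
  then show ?thesis
    using assms(2) by (simp add: set_borel_measurable_def borel_measurable_restrict_space_iff)
qed

text \<open>The sequence may hit \<open>u\<close>: a filter \<open>at u within A\<close> ignores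
  whether \<open>u\<close> itself lies in \<open>A\<close>, so right-continuity is continuity within
  \<open>{u..}\<close>.\<close>

lemma tendsto_at_right_sequence:
  fixes f :: "real \<Rightarrow> real"
  assumes "continuous (at_right u) f" "r \<longlonglongrightarrow> u" "\<And>k. u \<le> r k"
  shows "(\<lambda>k. f (r k)) \<longlonglongrightarrow> f u"
proof -
  have "{u..} - {u} = {u<..} - {u}" by auto
  then have "at u within {u..} = at_right u" by (simp add: at_within_def)
  then have "continuous (at u within {u..}) f" using assms(1) by simp
  then show ?thesis
    using assms(2,3) by (auto simp: continuous_within_sequentially comp_def)
qed

section \<open>Riemann-Stieltjes sums of non-increasing integrands\<close>

text \<open>There are \<open>Suc k\<close> cells, so that \<open>k = 0\<close> causes no division by
  zero and the cells are indexed by \<open>i \<le> k\<close>.\<close>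

definition grid :: "real \<Rightarrow> real \<Rightarrow> nat \<Rightarrow> nat \<Rightarrow> real" where
  "grid a b k i = a + (b - a) * real i / real (Suc k)"

lemma grid_0 [simp]: "grid a b k 0 = a"
  by (simp add: grid_def)

lemma grid_last [simp]: "grid a b k (Suc k) = b"
proof -
  have *: "(b - a) * real (Suc k) / real (Suc k) = b - a" by simp
  show ?thesis unfolding grid_def * by simp
qed

lemma grid_mono: "a \<le> b \<Longrightarrow> i \<le> j \<Longrightarrow> grid a b k i \<le> grid a b k j"
  unfolding grid_def by (intro add_left_mono divide_right_mono mult_left_mono) auto

lemma grid_bounds:
  assumes "a \<le> b" "i \<le> Suc k"
  shows "a \<le> grid a b k i" "grid a b k i \<le> b"
  using grid_mono[OF assms(1), of 0 i k] grid_mono[OF assms, of k] by auto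

lemma grid_step: "grid a b k (Suc i) - grid a b k i = (b - a) / real (Suc k)"
proof -
  define n where "n = real (Suc k)"
  have *: "(b - a) * real (Suc i) = (b - a) * real i + (b - a)" by (simp add: algebra_simps)
  show ?thesis unfolding grid_def * add_divide_distrib n_def[symmetric] by simp
qed

lemma grid_cell:
  assumes "a < u" "u \<le> b"
  obtains j where "j \<le> k" "grid a b k j < u" "u \<le> grid a b k (Suc j)"
proof -
  \<comment> \<open>The cell is the one ending at the first grid point not below \<open>u\<close>;
    that point is not the first of all because \<open>a < u\<close>.\<close>
  define n where "n = (LEAST n. u \<le> grid a b k n)"
  have ex: "u \<le> grid a b k (Suc k)" using assms by simp
  have n: "u \<le> grid a b k n" unfolding n_def using ex by (rule LeastI)
  have le: "n \<le> Suc k" unfolding n_def using ex by (rule Least_le)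
  have "n \<noteq> 0" using n assms by (intro notI) simp
  then obtain j where j: "n = Suc j" by (cases n) auto
  have "\<not> u \<le> grid a b k j" using not_less_Least[of j "\<lambda>n. u \<le> grid a b k n"] j n_def by auto
  with that[of j] n le j show thesis by auto
qed

locale stieltjes =
  fixes F :: "real \<Rightarrow> real"
  assumes mono_F: "s \<le> t \<Longrightarrow> F s \<le> F t"
    and right_cont_F: "continuous (at_right t) F"
begin

abbreviation "\<mu> \<equiv> interval_measure F"

lemma measure_Ioc: "a \<le> b \<Longrightarrow> measure \<mu> {a<..b} = F b - F a"
  and emeasure_Ioc: "a \<le> b \<Longrightarrow> emeasure \<mu> {a<..b} = ennreal (F b - F a)"
  using measure_interval_measure_Ioc[of a b F] emeasure_interval_measure_Ioc[of a b F]
    mono_F right_cont_F by auto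

lemma integrable_indicator_Ioc: "a \<le> b \<Longrightarrow> integrable \<mu> (indicator {a<..b} :: real \<Rightarrow> real)"
  by (simp add: emeasure_Ioc)

context
  fixes f :: "real \<Rightarrow> real" and a b :: real
  assumes ab: "a \<le> b" and f: "antimono_on {a..b} f"
begin

lemma antimono_bounds: "u \<in> {a..b} \<Longrightarrow> f b \<le> f u" "u \<in> {a..b} \<Longrightarrow> f u \<le> f a"
  using f ab by (auto simp: monotone_on_def)

lemma abs_antimono_le: "u \<in> {a..b} \<Longrightarrow> \<bar>f u\<bar> \<le> \<bar>f a\<bar> + \<bar>f b\<bar>"
  using antimono_bounds[of u] by auto

lemma set_measurable_antimono:
  assumes "A \<in> sets borel" "A \<subseteq> {a..b}"
  shows "(\<lambda>u. indicator A u * f u) \<in> borel_measurable borel"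
proof -
  have "antimono_on A f" using f assms(2) by (rule monotone_on_subset)
  then show ?thesis
    using borel_measurable_antimono_on[of A f] assms(1) by (simp add: set_borel_measurable_def)
qed

lemma set_integrable_antimono:
  assumes "A \<in> sets borel" "A \<subseteq> {a<..b}"
  shows "set_integrable \<mu> A f"
  unfolding set_integrable_def
proof (rule Bochner_Integration.integrable_bound)
  show "integrable \<mu> (\<lambda>u. (\<bar>f a\<bar> + \<bar>f b\<bar>) * indicator {a<..b} u)"
    using integrable_indicator_Ioc[OF ab] by (rule integrable_mult_right)
  show "(\<lambda>u. indicator A u *\<^sub>R f u) \<in> borel_measurable \<mu>"
  proof -
    have "A \<subseteq> {a..b}" using assms(2) by auto
    then show ?thesis using set_measurable_antimono[OF assms(1)] by simp
  qed
  show "AE u in \<mu>. norm (indicator A u *\<^sub>R f u) \<le> norm ((\<bar>f a\<bar> + \<bar>f b\<bar>) * indicator {a<..b} u)"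
    using assms(2) abs_antimono_le by (intro AE_I2) (fastforce simp: indicator_def)
qed

text \<open>Where \<open>A\<close> leaves out part of the interval the integrand is 0, and the
  constant \<open>f a\<close> dominates it there because of its sign.\<close>

lemma set_integral_antimono_le:
  assumes "A \<in> sets borel" "A \<subseteq> {a<..b}" "0 \<le> f a"
  shows "(LINT u:A|\<mu>. f u) \<le> f a * (F b - F a)"
proof -
  have "(LINT u:A|\<mu>. f u) \<le> (\<integral>u. f a * indicator {a<..b} u \<partial>\<mu>)"
    unfolding set_lebesgue_integral_def
  proof (rule integral_mono)
    show "integrable \<mu> (\<lambda>u. indicator A u *\<^sub>R f u)"
      using set_integrable_antimono[OF assms(1,2)] by (simp add: set_integrable_def)
    show "integrable \<mu> (\<lambda>u. f a * indicator {a<..b} u)"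
      using integrable_indicator_Ioc[OF ab] by (rule integrable_mult_right)
    show "indicator A u *\<^sub>R f u \<le> f a * indicator {a<..b} u" for u
      using assms(2,3) antimono_bounds[of u] by (auto simp: indicator_def)
  qed
  also have "\<dots> = f a * (F b - F a)" using ab by (simp add: measure_Ioc)
  finally show ?thesis .
qed

lemma set_integral_antimono_ge: "f b * (F b - F a) \<le> (LINT u:{a<..b}|\<mu>. f u)"
proof -
  have "f b * (F b - F a) = (\<integral>u. f b * indicator {a<..b} u \<partial>\<mu>)" using ab by (simp add: measure_Ioc)
  also have "\<dots> \<le> (LINT u:{a<..b}|\<mu>. f u)"
    unfolding set_lebesgue_integral_def
  proof (rule integral_mono)
    show "integrable \<mu> (\<lambda>u. indicator {a<..b} u *\<^sub>R f u)"
      using set_integrable_antimono[of "{a<..b}"] by (simp add: set_integrable_def)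
    show "integrable \<mu> (\<lambda>u. f b * indicator {a<..b} u)"
      using integrable_indicator_Ioc[OF ab] by (rule integrable_mult_right)
    show "f b * indicator {a<..b} u \<le> indicator {a<..b} u *\<^sub>R f u" for u
      using antimono_bounds[of u] by (auto simp: indicator_def)
  qed
  finally show ?thesis .
qed

text \<open>Applied path by path, this makes the integrals along the demand process measurable in
  \<open>\<omega>\<close>.  Right end points are needed for \<open>f\<close>, which is right-continuous; left end points are needed
  for \<open>P\<close>, whose limit at \<open>u\<close> only sees times before \<open>u\<close>.\<close>

lemma riemann_stieltjes_sums:
  assumes rc: "\<And>t. a \<le> t \<Longrightarrow> t < b \<Longrightarrow> continuous (at_right t) f"
    and P: "\<And>v w. a \<le> v \<Longrightarrow> v \<le> w \<Longrightarrow> w \<le> b \<Longrightarrow> P v \<Longrightarrow> P w"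
  shows "(\<lambda>k. \<Sum>i\<le>k. if P (grid a b k i)
             then f (grid a b k (Suc i)) * (F (grid a b k (Suc i)) - F (grid a b k i)) else 0)
         \<longlonglongrightarrow> (LINT u:{u \<in> {a<..b}. \<exists>v\<in>{a..<u}. P v}|\<mu>. f u)"
proof -
  let ?S = "{u \<in> {a<..b}. \<exists>v\<in>{a..<u}. P v}"
  define p where "p k i = grid a b k i" for k i
  \<comment> \<open>Step functions whose integrals are exactly the sums: on each cell, the value of
    \<open>f\<close> at the right end, switched on or off by \<open>P\<close> at the left
    end.\<close>
  define g where "g k u = (\<Sum>i\<le>k. (if P (p k i) then f (p k (Suc i)) else 0)
      * indicator {p k i<..p k (Suc i)} u)" for k u
  note pm = grid_mono[OF ab, folded p_def]
  have pb: "i \<le> Suc k \<Longrightarrow> a \<le> p k i" "i \<le> Suc k \<Longrightarrow> p k i \<le> b" for i k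
    using grid_bounds[OF ab] by (auto simp: p_def)
  have int_g: "(\<integral>u. g k u \<partial>\<mu>) = (\<Sum>i\<le>k. if P (p k i)
             then f (p k (Suc i)) * (F (p k (Suc i)) - F (p k i)) else 0)" for k
    unfolding g_def
    by (subst Bochner_Integration.integral_sum)
       (auto simp: measure_Ioc pm intro!: sum.cong integrable_indicator_Ioc)
  have g_eq: "g k u = (if P (p k j) then f (p k (Suc j)) else 0)"
    if "j \<le> k" "p k j < u" "u \<le> p k (Suc j)" for k u j
  proof -
    have "g k u = (\<Sum>i\<le>k. if i = j then (if P (p k j) then f (p k (Suc j)) else 0) else 0)"
      unfolding g_def
    proof (rule sum.cong)
      fix i assume "i \<in> {..k}"
      show "(if P (p k i) then f (p k (Suc i)) else 0) * indicator {p k i<..p k (Suc i)} u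
          = (if i = j then (if P (p k j) then f (p k (Suc j)) else 0) else 0)"
        using that pm[of "Suc i" j k] pm[of "Suc j" i k]
        by (cases i j rule: linorder_cases) (auto simp: indicator_def)
    qed simp
    also have "\<dots> = (if P (p k j) then f (p k (Suc j)) else 0)"
      using that(1) by simp
    finally show ?thesis .
  qed
  have g_out: "g k u = 0" if "u \<notin> {a<..b}" for k u
    unfolding g_def
  proof (intro sum.neutral ballI)
    fix i assume "i \<in> {..k}"
    then have "u \<notin> {p k i<..p k (Suc i)}" using that pb(1)[of i k] pb(2)[of "Suc i" k] by auto
    then show "(if P (p k i) then f (p k (Suc i)) else 0) * indicator {p k i<..p k (Suc i)} u = 0"
      by simp
  qed
  have ex: "\<exists>j\<le>k. p k j < u \<and> u \<le> p k (Suc j)" if "u \<in> {a<..b}" for k u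
    using grid_cell[of a u b k] that unfolding p_def by (auto elim: grid_cell)
  have "(\<lambda>k. \<integral>u. g k u \<partial>\<mu>) \<longlonglongrightarrow> (\<integral>u. indicator ?S u * f u \<partial>\<mu>)"
  proof (rule integral_dominated_convergence)
    \<comment> \<open>The set is upward closed within \<open>{a<..b}\<close>, hence an interval, and
      therefore Borel whatever \<open>P\<close> is.\<close>
    have "is_interval ?S"
      unfolding is_interval_1 by force
    then have "?S \<in> sets borel" by (rule real_interval_borel_measurable)
    moreover have "?S \<subseteq> {a..b}" by auto
    ultimately show "(\<lambda>u. indicator ?S u * f u) \<in> borel_measurable \<mu>"
      using set_measurable_antimono by simp
    show "g k \<in> borel_measurable \<mu>" for k
      unfolding g_def by measurable
    show "integrable \<mu> (\<lambda>u. (\<bar>f a\<bar> + \<bar>f b\<bar>) * indicator {a<..b} u)"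
      using integrable_indicator_Ioc[OF ab] by (rule integrable_mult_right)
    show "AE u in \<mu>. norm (g k u) \<le> (\<bar>f a\<bar> + \<bar>f b\<bar>) * indicator {a<..b} u" for k
    proof (rule AE_I2)
      fix u
      show "norm (g k u) \<le> (\<bar>f a\<bar> + \<bar>f b\<bar>) * indicator {a<..b} u"
      proof (cases "u \<in> {a<..b}")
        case True
        with ex[of u k] obtain j where "j \<le> k" "p k j < u" "u \<le> p k (Suc j)" by auto
        with g_eq[OF this] show ?thesis
          using True abs_antimono_le[of "p k (Suc j)"] pb[of "Suc j" k] by auto
      qed (simp add: g_out)
    qed
    show "AE u in \<mu>. (\<lambda>k. g k u) \<longlonglongrightarrow> indicator ?S u * f u"
    proof (rule AE_I2)
      fix u
      show "(\<lambda>k. g k u) \<longlonglongrightarrow> indicator ?S u * f u"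
      proof (cases "u \<in> {a<..b}")
        case True
        have "\<forall>k. \<exists>j\<le>k. p k j < u \<and> u \<le> p k (Suc j)" using ex[OF True] by blast
        then obtain j where j: "j k \<le> k" "p k (j k) < u" "u \<le> p k (Suc (j k))" for k
          by metis
        have step: "p k (Suc (j k)) - p k (j k) = (b - a) / real (Suc k)" for k
          unfolding p_def by (rule grid_step)
        have near: "u - (b - a) / real (Suc k) \<le> p k (j k)"
          "p k (Suc (j k)) \<le> u + (b - a) / real (Suc k)" for k
          using j(2,3)[of k] step[of k] by linarith+
        have h: "(\<lambda>k. (b - a) / real (Suc k)) \<longlonglongrightarrow> 0"
          using LIMSEQ_Suc[OF lim_const_over_n[of "b - a"]] by simp
        have lo: "(\<lambda>k. p k (j k)) \<longlonglongrightarrow> u"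
        proof (rule tendsto_sandwich)
          show "(\<lambda>k. u - (b - a) / real (Suc k)) \<longlonglongrightarrow> u" using tendsto_diff[OF tendsto_const h] by simp
          show "\<forall>\<^sub>F k in sequentially. u - (b - a) / real (Suc k) \<le> p k (j k)"
            using near by simp
          show "\<forall>\<^sub>F k in sequentially. p k (j k) \<le> u" using j(2) by (simp add: less_imp_le)
        qed simp
        have hi: "(\<lambda>k. p k (Suc (j k))) \<longlonglongrightarrow> u"
        proof (rule tendsto_sandwich[where f = "\<lambda>_. u"])
          show "(\<lambda>k. u + (b - a) / real (Suc k)) \<longlonglongrightarrow> u" using tendsto_add[OF tendsto_const h] by simp
          show "\<forall>\<^sub>F k in sequentially. p k (Suc (j k)) \<le> u + (b - a) / real (Suc k)"
            using near by simp
          show "\<forall>\<^sub>F k in sequentially. u \<le> p k (Suc (j k))" using j(3) by simp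
        qed simp
        \<comment> \<open>Right-continuity is assumed only before \<open>b\<close>; at
          \<open>b\<close> itself the right end of the cell is always \<open>b\<close>.\<close>
        have flim: "(\<lambda>k. f (p k (Suc (j k)))) \<longlonglongrightarrow> f u"
        proof (cases "u = b")
          case True
          then have "p k (Suc (j k)) = u" for k using j[of k] pb[of "Suc (j k)" k] by auto
          then show ?thesis by simp
        next
          case False
          with True have "continuous (at_right u) f" by (intro rc) auto
          then show ?thesis using hi j(3) by (rule tendsto_at_right_sequence)
        qed
        have g: "g k u = (if P (p k (j k)) then f (p k (Suc (j k))) else 0)" for k
          using g_eq j by blast
        \<comment> \<open>The left ends of the cells stay strictly below \<open>u\<close> and tend
          to \<open>u\<close>. They eventually pass any witness \<open>v < u\<close>, after which
          \<open>P\<close> holds at them by monotonicity; if there is no witness, \<open>P\<close>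
          fails at all of them.\<close>
        show ?thesis
        proof (cases "u \<in> ?S")
          case True
          then obtain v where v: "a \<le> v" "v < u" "P v" by auto
          have "\<forall>\<^sub>F k in sequentially. v < p k (j k)" using lo v(2) by (rule order_tendstoD)
          then have "\<forall>\<^sub>F k in sequentially. f (p k (Suc (j k))) = g k u"
          proof (rule eventually_mono)
            fix k assume "v < p k (j k)"
            then have "P (p k (j k))" using v j(1)[of k] pb(2)[of "j k" k] P[of v "p k (j k)"] by auto
            then show "f (p k (Suc (j k))) = g k u" using g by simp
          qed
          with flim have "(\<lambda>k. g k u) \<longlonglongrightarrow> f u" by (rule Lim_transform_eventually)
          then show ?thesis using True by simp
        next
          case False
          then have "\<not> P (p k (j k))" for k
            using \<open>u \<in> {a<..b}\<close> j[of k] pb(1)[of "j k" k] by auto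
          then show ?thesis using False g by simp
        qed
      next
        case False
        then have "u \<notin> ?S" by blast
        then show ?thesis using g_out[OF False] by simp
      qed
    qed
  qed
  then show ?thesis unfolding int_g p_def set_lebesgue_integral_def real_scaleR_def .
qed

end

end

text \<open>Nothing is asked of the continuity of \<open>\<phi>\<close>. A step across a jump of
  \<open>\<phi>\<close> may have an error of the order of the step itself, so that a derivative
  criterion gives nothing there; but the sum of all errors is the mesh times a fixed number,
  \<open>K * ((b - a) + (\<phi> a - \<phi> b))\<close>.\<close>

lemma le_of_small_increments:
  fixes C \<phi> :: "real \<Rightarrow> real"
  assumes "a \<le> b"
    and incr: "\<And>s t. a \<le> s \<Longrightarrow> s \<le> t \<Longrightarrow> t \<le> b \<Longrightarrow>
      C s - K * (t - s) * ((t - s) + (\<phi> s - \<phi> t)) \<le> C t"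
  shows "C a \<le> C b"
proof -
  have "C a - C b \<le> (b - a) / real (Suc k) * (K * ((b - a) + (\<phi> a - \<phi> b)))" for k
  proof -
    define h where "h = (b - a) / real (Suc k)"
    let ?p = "grid a b k"
    have "C a - C b = (\<Sum>i\<le>k. C (?p i) - C (?p (Suc i)))"
      by (simp add: sum_telescope[of "\<lambda>i. C (?p i)"])
    also have "\<dots> \<le> (\<Sum>i\<le>k. K * h * (h + (\<phi> (?p i) - \<phi> (?p (Suc i)))))"
    proof (rule sum_mono)
      fix i assume "i \<in> {..k}"
      then have "C (?p i) - K * (?p (Suc i) - ?p i) * ((?p (Suc i) - ?p i) + (\<phi> (?p i) - \<phi> (?p (Suc i))))
          \<le> C (?p (Suc i))"
        using grid_bounds[OF assms(1)] grid_mono[OF assms(1)] by (intro incr) auto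
      then show "C (?p i) - C (?p (Suc i)) \<le> K * h * (h + (\<phi> (?p i) - \<phi> (?p (Suc i))))"
        unfolding grid_step h_def[symmetric] by linarith
    qed
    also have "\<dots> = K * h * ((\<Sum>i\<le>k. h) + (\<Sum>i\<le>k. \<phi> (?p i) - \<phi> (?p (Suc i))))"
      by (simp only: sum_distrib_left[symmetric] sum.distrib)
    also have "(\<Sum>i\<le>k. \<phi> (?p i) - \<phi> (?p (Suc i))) = \<phi> a - \<phi> b"
      by (simp add: sum_telescope[of "\<lambda>i. \<phi> (?p i)"])
    also have "(\<Sum>i\<le>k. h) = b - a"
      unfolding h_def by simp
    finally show ?thesis unfolding h_def[symmetric] by (simp add: mult_ac)
  qed
  moreover have "(\<lambda>k. (b - a) / real (Suc k) * (K * ((b - a) + (\<phi> a - \<phi> b)))) \<longlonglongrightarrow> 0"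
    by (rule tendsto_mult_left_zero) (use LIMSEQ_Suc[OF lim_const_over_n[of "b - a"]] in simp)
  ultimately have "C a - C b \<le> 0"
    by (intro LIMSEQ_le_const) auto
  then show ?thesis by simp
qed

lemma (in prob_space) poisson_mean:
  assumes X[measurable]: "X \<in> measurable M (count_space UNIV)" and m: "0 \<le> m"
    and pmf: "\<And>k. prob {\<omega> \<in> space M. X \<omega> = k} = m ^ k / fact k * exp (- m)"
  shows "has_bochner_integral M (\<lambda>\<omega>. real (X \<omega>)) m"
proof (rule has_bochner_integral_nn_integral)
  let ?w = "\<lambda>k. real k * (m ^ k / fact k * exp (- m))"
  \<comment> \<open>Cancelling the factor \<open>k\<close> against \<open>fact k\<close> shifts the
    index by one and leaves \<open>m * exp (- m)\<close> times the exponential series; the term for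
    \<open>k = 0\<close> vanishes.\<close>
  have "(\<lambda>k. m * exp (- m) * (m ^ k /\<^sub>R fact k)) sums (m * exp (- m) * exp m)"
    by (intro sums_mult exp_converges)
  moreover have "m * exp (- m) * (m ^ k /\<^sub>R fact k) = ?w (Suc k)" for k
    by (simp add: divide_simps del: of_nat_Suc)
  moreover have "m * exp (- m) * exp m = m" by (simp add: exp_minus)
  ultimately have "(\<lambda>k. ?w (Suc k)) sums m" by simp
  then have w: "?w sums m" using sums_Suc[of ?w m] by simp
  have "(\<integral>\<^sup>+\<omega>. ennreal (real (X \<omega>)) \<partial>M)
      = (\<integral>\<^sup>+\<omega>. (\<Sum>k. ennreal (real k) * indicator {\<omega> \<in> space M. X \<omega> = k} \<omega>) \<partial>M)"
  proof (rule nn_integral_cong)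
    fix \<omega> assume "\<omega> \<in> space M"
    then show "ennreal (real (X \<omega>)) = (\<Sum>k. ennreal (real k) * indicator {\<omega> \<in> space M. X \<omega> = k} \<omega>)"
      by (subst suminf_finite[of "{X \<omega>}"]) auto
  qed
  also have "\<dots> = (\<Sum>k. \<integral>\<^sup>+\<omega>. ennreal (real k) * indicator {\<omega> \<in> space M. X \<omega> = k} \<omega> \<partial>M)"
    by (rule nn_integral_suminf) measurable
  also have "\<dots> = (\<Sum>k. ennreal (?w k))"
    by (intro suminf_cong, subst nn_integral_cmult_indicator)
       (use m in \<open>auto simp: emeasure_eq_measure pmf ennreal_mult'[symmetric]\<close>)
  also have "\<dots> = ennreal m"
    using w m by (intro suminf_ennreal_eq) auto
  finally show "(\<integral>\<^sup>+\<omega>. ennreal (real (X \<omega>)) \<partial>M) = ennreal m" .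
qed (use m in auto)

lemma continuous_clamp_at_right:
  fixes f :: "real \<Rightarrow> real"
  assumes "0 \<le> T" "\<And>t. 0 \<le> t \<Longrightarrow> t < T \<Longrightarrow> continuous (at_right t) f"
  shows "continuous (at_right t) (\<lambda>u. f (max 0 (min T u)))"
proof -
  consider "t < 0" | "0 \<le> t" "t < T" | "T \<le> t" using assms(1) by linarith
  then show ?thesis
  proof cases
    case 1
    have "\<forall>\<^sub>F u in at_right t. f (max 0 (min T t)) = f (max 0 (min T u))"
      using 1 assms(1) unfolding eventually_at_right_field by (intro exI[of _ 0]) auto
    then show ?thesis unfolding continuous_within by (rule Lim_transform_eventually[rotated]) simp
  next
    case 2
    have "\<forall>\<^sub>F u in at_right t. f u = f (max 0 (min T u))"
      using 2 unfolding eventually_at_right_field by (intro exI[of _ T]) auto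
    moreover have "(f \<longlongrightarrow> f (max 0 (min T t))) (at_right t)"
      using assms(2)[OF 2] 2 by (simp add: continuous_within)
    ultimately show ?thesis unfolding continuous_within by (rule Lim_transform_eventually[rotated])
  next
    case 3
    have "\<forall>\<^sub>F u in at_right t. f (max 0 (min T t)) = f (max 0 (min T u))"
      using 3 assms(1) unfolding eventually_at_right_field by (intro exI[of _ "t + 1"]) auto
    then show ?thesis unfolding continuous_within by (rule Lim_transform_eventually[rotated]) simp
  qed
qed

lemma regular_nonincreasingD:
  assumes "regular_nonincreasing T f"
  shows "antimono_on {0..T} f" "\<And>t. 0 \<le> t \<Longrightarrow> t < T \<Longrightarrow> continuous (at_right t) f"
  using assms by (auto simp: regular_nonincreasing_def)

lemma antimono_on_mult:
  fixes f g :: "real \<Rightarrow> real"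
  assumes "antimono_on A f" "antimono_on A g" "\<And>u. u \<in> A \<Longrightarrow> 0 \<le> f u" "\<And>u. u \<in> A \<Longrightarrow> 0 \<le> g u"
  shows "antimono_on A (\<lambda>u. f u * g u)"
  using assms unfolding monotone_on_def by (auto intro!: mult_mono)

interpretation identity: stieltjes "\<lambda>x. x"
  by unfold_locales auto

lemma set_lborel_Icc_eq_Ioc:
  fixes f :: "real \<Rightarrow> real"
  shows "(LBINT u:{a..b}. f u) = (LBINT u:{a<..b}. f u)"
  unfolding set_lebesgue_integral_def
  by (rule integral_discrete_difference[of "{a}"]) (auto simp: indicator_def)

section \<open>Increments of the demand process\<close>

locale poisson_demand = prob_space M for M :: "'a measure" +
  fixes N :: "real \<Rightarrow> 'a \<Rightarrow> nat" and lam :: "real \<Rightarrow> real" and T :: real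
  assumes T: "0 \<le> T"
    and lam_nonneg: "\<And>t. t \<in> {0..T} \<Longrightarrow> 0 \<le> lam t"
    and lam_antimono: "antimono_on {0..T} lam"
    and N_process: "nonhom_poisson_process M T lam N"
begin

lemma N_measurable: "t \<in> {0..T} \<Longrightarrow> N t \<in> measurable M (count_space UNIV)"
  and N_0: "\<omega> \<in> space M \<Longrightarrow> N 0 \<omega> = 0"
  and N_right_cont: "\<omega> \<in> space M \<Longrightarrow> 0 \<le> t \<Longrightarrow> t < T \<Longrightarrow> continuous (at_right t) (\<lambda>s. real (N s \<omega>))"
  using N_process by (auto simp: nonhom_poisson_process_def)

lemma N_mono: "\<omega> \<in> space M \<Longrightarrow> 0 \<le> s \<Longrightarrow> s \<le> t \<Longrightarrow> t \<le> T \<Longrightarrow> N s \<omega> \<le> N t \<omega>"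
  using N_process by (auto simp: nonhom_poisson_process_def mono_on_def)

definition mean :: "real \<Rightarrow> real \<Rightarrow> real" where
  "mean s t = (LBINT u:{s..t}. lam u)"

lemma mean_bounds:
  assumes "0 \<le> s" "s \<le> t" "t \<le> T"
  shows "0 \<le> mean s t" "mean s t \<le> lam 0 * (t - s)"
proof -
  have anti: "antimono_on {s..t} lam"
    using lam_antimono by (rule monotone_on_subset) (use assms in auto)
  have *: "mean s t = (LINT u:{s<..t}|interval_measure (\<lambda>x. x). lam u)"
    by (simp only: mean_def set_lborel_Icc_eq_Ioc) (simp only: lborel_eq_real)
  have "0 \<le> lam t * (t - s)" using lam_nonneg[of t] assms by simp
  also have "\<dots> \<le> mean s t"
    unfolding * using identity.set_integral_antimono_ge[OF assms(2) anti] .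
  finally show "0 \<le> mean s t" .
  have "mean s t \<le> lam s * (t - s)"
    unfolding * using lam_nonneg[of s] assms
    by (intro identity.set_integral_antimono_le[OF assms(2) anti]) auto
  also have "\<dots> \<le> lam 0 * (t - s)"
    using lam_antimono assms by (intro mult_right_mono) (auto simp: monotone_on_def)
  finally show "mean s t \<le> lam 0 * (t - s)" .
qed

lemma increment:
  assumes "0 \<le> s" "s \<le> t" "t \<le> T"
  shows "has_bochner_integral M (\<lambda>\<omega>. real (N t \<omega>) - real (N s \<omega>)) (mean s t)"
proof -
  note [measurable] = N_measurable
  have st: "s \<in> {0..T}" "t \<in> {0..T}" using assms by auto
  have pmf: "\<forall>k. measure M {\<omega> \<in> space M. N t \<omega> - N s \<omega> = k} = mean s t ^ k / fact k * exp (- mean s t)"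
    using N_process assms by (simp add: nonhom_poisson_process_def mean_def)
  have "has_bochner_integral M (\<lambda>\<omega>. real (N t \<omega> - N s \<omega>)) (mean s t)"
    using mean_bounds[OF assms] pmf st by (intro poisson_mean) (auto intro: measurable_compose_countable)
  \<comment> \<open>The process is specified through truncated differences of naturals, which are
    true differences along non-decreasing paths.\<close>
  then show ?thesis
    by (rule has_bochner_integral_cong[THEN iffD1, rotated -1])
       (use N_mono[OF _ assms] in \<open>auto simp: of_nat_diff\<close>)
qed

text \<open>Independence is given for increments only. On the partition \<open>0, s, t\<close> the
  first increment is \<open>N s\<close> itself, since \<open>N 0 = 0\<close>; \<open>Y\<close> turns
  it into the indicator of depletion and embeds the second increment into the reals, and the
  expectation of the product factors.\<close>

lemma increment_indep:
  assumes "0 \<le> s" "s \<le> t" "t \<le> T"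
  shows "has_bochner_integral M (\<lambda>\<omega>. of_bool (x \<le> N s \<omega>) * (real (N t \<omega>) - real (N s \<omega>)))
    (prob {\<omega> \<in> space M. x \<le> N s \<omega>} * mean s t)"
proof -
  define p where "p i = (if i = 0 then 0 else if i = 1 then s else t)" for i :: nat
  define Y where "Y i n = (if i = 0 then of_bool (x \<le> n) else real n)" for i n :: nat
  have [measurable]: "N s \<in> measurable M (count_space UNIV)" "N t \<in> measurable M (count_space UNIV)"
    using assms by (auto intro: N_measurable)
  have "indep_vars (\<lambda>_. count_space UNIV) (\<lambda>i \<omega>. N (p (Suc i)) \<omega> - N (p i) \<omega>) {..<2}"
  proof -
    have "indep_vars (\<lambda>_. count_space UNIV) (\<lambda>i \<omega>. N (q (Suc i)) \<omega> - N (q i) \<omega>) {..<n}"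
      if "0 \<le> q 0" "\<forall>i<n. q i \<le> q (Suc i)" "q n \<le> T" for n and q :: "nat \<Rightarrow> real"
      using N_process that unfolding nonhom_poisson_process_def by blast
    moreover have "0 \<le> p 0" "\<forall>i<2. p i \<le> p (Suc i)" "p 2 \<le> T"
      using assms by (auto simp: p_def less_2_cases_iff)
    ultimately show ?thesis by blast
  qed
  then have ind: "indep_vars (\<lambda>_. borel) (\<lambda>i \<omega>. Y i (N (p (Suc i)) \<omega> - N (p i) \<omega>)) {..<2}"
    by (rule indep_vars_compose2) auto
  have Y0: "Y 0 (N (p (Suc 0)) \<omega> - N (p 0) \<omega>) = indicator {\<omega> \<in> space M. x \<le> N s \<omega>} \<omega>"
    if "\<omega> \<in> space M" for \<omega>
    using that by (auto simp: Y_def p_def N_0)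
  have Y1: "Y 1 (N (p (Suc 1)) \<omega> - N (p 1) \<omega>) = real (N t \<omega>) - real (N s \<omega>)"
    if "\<omega> \<in> space M" for \<omega>
    using N_mono[OF that assms] by (auto simp: Y_def p_def of_nat_diff)
  have int1: "has_bochner_integral M (\<lambda>\<omega>. Y 1 (N (p (Suc 1)) \<omega> - N (p 1) \<omega>)) (mean s t)"
    using increment[OF assms] Y1 by (simp cong: has_bochner_integral_cong)
  have "has_bochner_integral M (indicator {\<omega> \<in> space M. x \<le> N s \<omega>} :: 'a \<Rightarrow> real)
      (prob {\<omega> \<in> space M. x \<le> N s \<omega>})"
    by (intro has_bochner_integral_real_indicator) (auto simp: emeasure_eq_measure)
  then have int0: "has_bochner_integral M (\<lambda>\<omega>. Y 0 (N (p (Suc 0)) \<omega> - N (p 0) \<omega>))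
      (prob {\<omega> \<in> space M. x \<le> N s \<omega>})"
    using Y0 by (simp cong: has_bochner_integral_cong)
  have two: "{..<2::nat} = {0, 1}" by auto
  have int: "integrable M (\<lambda>\<omega>. Y i (N (p (Suc i)) \<omega> - N (p i) \<omega>))" if "i \<in> {..<2}" for i
    using that int0 int1 unfolding two by (auto simp: has_bochner_integral_iff)
  have "has_bochner_integral M (\<lambda>\<omega>. \<Prod>i\<in>{..<2}. Y i (N (p (Suc i)) \<omega> - N (p i) \<omega>))
      (\<Prod>i\<in>{..<2}. \<integral>\<omega>. Y i (N (p (Suc i)) \<omega> - N (p i) \<omega>) \<partial>M)"
    unfolding has_bochner_integral_iff
    using indep_vars_integrable[OF _ ind int] indep_vars_lebesgue_integral[OF _ ind int] by simp
  moreover have "(\<Prod>i\<in>{..<2}. \<integral>\<omega>. Y i (N (p (Suc i)) \<omega> - N (p i) \<omega>) \<partial>M)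
      = prob {\<omega> \<in> space M. x \<le> N s \<omega>} * mean s t"
    using int0 int1 unfolding two by (simp add: has_bochner_integral_iff)
  moreover have "(\<Prod>i\<in>{..<2}. Y i (N (p (Suc i)) \<omega> - N (p i) \<omega>))
      = of_bool (x \<le> N s \<omega>) * (real (N t \<omega>) - real (N s \<omega>))" if "\<omega> \<in> space M" for \<omega>
    using Y0[OF that] Y1[OF that] that unfolding two by (simp add: indicator_def)
  ultimately show ?thesis by (simp cong: has_bochner_integral_cong)
qed

end

section \<open>Charges along a path of the demand process\<close>

context poisson_demand begin

text \<open>A demand at \<open>u\<close> is charged if the level was reached strictly before
  \<open>u\<close>, so the one taking the last unit is free. Looking back no further than
  \<open>s\<close> makes the integral depend on the path on \<open>[s, t]\<close> alone. Level 0
  charges every demand, so that the \<open>c3\<close> term is an instance too.\<close>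

definition demand_integral :: "(real \<Rightarrow> real) \<Rightarrow> nat \<Rightarrow> real \<Rightarrow> real \<Rightarrow> 'a \<Rightarrow> real" where
  "demand_integral f x s t \<omega> =
     (LINT u:{u \<in> {s<..t}. \<exists>v\<in>{s..<u}. x \<le> N v \<omega>}|path_measure T N \<omega>. f u)"

lemma path_stieltjes: "\<omega> \<in> space M \<Longrightarrow> stieltjes (\<lambda>u. real (N (max 0 (min T u)) \<omega>))"
proof
  fix s t :: real assume "\<omega> \<in> space M" "s \<le> t"
  then show "real (N (max 0 (min T s)) \<omega>) \<le> real (N (max 0 (min T t)) \<omega>)"
    using T N_mono[of \<omega> "max 0 (min T s)" "max 0 (min T t)"] by auto
next
  fix t :: real assume "\<omega> \<in> space M"
  then show "continuous (at_right t) (\<lambda>u. real (N (max 0 (min T u)) \<omega>))"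
    using T N_right_cont by (intro continuous_clamp_at_right[where f = "\<lambda>u. real (N u \<omega>)"]) auto
qed

lemma depleted_set:
  "{u \<in> {s<..t}. \<exists>v\<in>{s..<u}. x \<le> N v \<omega>} \<in> sets borel" "{u \<in> {s<..t}. \<exists>v\<in>{s..<u}. x \<le> N v \<omega>} \<subseteq> {s<..t}"
proof -
  have "is_interval {u \<in> {s<..t}. \<exists>v\<in>{s..<u}. x \<le> N v \<omega>}"
    unfolding is_interval_1 by force
  then show "{u \<in> {s<..t}. \<exists>v\<in>{s..<u}. x \<le> N v \<omega>} \<in> sets borel"
    by (rule real_interval_borel_measurable)
qed blast

context
  fixes f :: "real \<Rightarrow> real"
  assumes f_anti: "antimono_on {0..T} f"
    and f_rc: "\<And>t. 0 \<le> t \<Longrightarrow> t < T \<Longrightarrow> continuous (at_right t) f"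
    and f_nonneg: "\<And>t. t \<in> {0..T} \<Longrightarrow> 0 \<le> f t"
begin

lemma f_anti_sub: "0 \<le> s \<Longrightarrow> t \<le> T \<Longrightarrow> antimono_on {s..t} f"
  using f_anti by (rule monotone_on_subset) auto

text \<open>If the stock is empty at \<open>s\<close>, every demand in \<open>{s<..t}\<close> is
  charged, which gives the last bound. Charges after a depletion inside the interval are estimated
  from below by 0.\<close>

lemma demand_integral_bounds:
  assumes \<omega>: "\<omega> \<in> space M" and st: "0 \<le> s" "s \<le> t" "t \<le> T"
  shows "0 \<le> demand_integral f x s t \<omega>"
    and "demand_integral f x s t \<omega> \<le> f s * (real (N t \<omega>) - real (N s \<omega>))"
    and "x \<le> N s \<omega> \<Longrightarrow> f t * (real (N t \<omega>) - real (N s \<omega>)) \<le> demand_integral f x s t \<omega>"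
proof -
  interpret stieltjes "\<lambda>u. real (N (max 0 (min T u)) \<omega>)"
    using \<omega> by (rule path_stieltjes)
  let ?A = "{u \<in> {s<..t}. \<exists>v\<in>{s..<u}. x \<le> N v \<omega>}"
  note anti = f_anti_sub[OF st(1,3)]
  have st': "max 0 (min T s) = s" "max 0 (min T t) = t" using st by auto
  have nn: "0 \<le> indicator ?A u *\<^sub>R f u" for u
    using f_nonneg[of u] st by (auto simp: indicator_def)
  then show "0 \<le> demand_integral f x s t \<omega>"
    unfolding demand_integral_def set_lebesgue_integral_def by (intro integral_nonneg_AE) auto
  have "0 \<le> f s" using f_nonneg[of s] st by auto
  then show "demand_integral f x s t \<omega> \<le> f s * (real (N t \<omega>) - real (N s \<omega>))"
    using set_integral_antimono_le[OF st(2) anti depleted_set] unfolding demand_integral_def path_measure_def st'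
    by blast
  show "f t * (real (N t \<omega>) - real (N s \<omega>)) \<le> demand_integral f x s t \<omega>" if "x \<le> N s \<omega>"
  proof -
    have "?A = {s<..t}" using that by force
    then show ?thesis
      using set_integral_antimono_ge[OF st(2) anti] unfolding demand_integral_def path_measure_def st' by simp
  qed
qed

lemma demand_integral_add:
  assumes \<omega>: "\<omega> \<in> space M" and rst: "0 \<le> r" "r \<le> s" "s \<le> t" "t \<le> T"
  shows "demand_integral f x r t \<omega> = demand_integral f x r s \<omega> + demand_integral f x s t \<omega>"
proof -
  interpret stieltjes "\<lambda>u. real (N (max 0 (min T u)) \<omega>)"
    using \<omega> by (rule path_stieltjes)
  let ?A = "\<lambda>r t. {u \<in> {r<..t}. \<exists>v\<in>{r..<u}. x \<le> N v \<omega>}"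
  have int: "set_integrable \<mu> (?A a b) f" if "0 \<le> a" "a \<le> b" "b \<le> T" for a b
    using that by (intro set_integrable_antimono[OF _ f_anti_sub] depleted_set) auto
  \<comment> \<open>The past before \<open>s\<close> is summarised by the state at \<open>s\<close>:
    a witness \<open>v\<close> may be moved up to \<open>max v s\<close>, which is still below
    \<open>u\<close>.\<close>
  have shift: "(\<exists>v\<in>{r..<u}. x \<le> N v \<omega>) \<longleftrightarrow> (\<exists>v\<in>{s..<u}. x \<le> N v \<omega>)" if "s < u" "u \<le> t" for u
  proof
    assume "\<exists>v\<in>{r..<u}. x \<le> N v \<omega>"
    then obtain v where v: "r \<le> v" "v < u" "x \<le> N v \<omega>" by auto
    have "N v \<omega> \<le> N (max v s) \<omega>" using v that rst by (intro N_mono[OF \<omega>]) auto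
    then show "\<exists>v\<in>{s..<u}. x \<le> N v \<omega>" using v that by (intro bexI[of _ "max v s"]) auto
  next
    assume "\<exists>v\<in>{s..<u}. x \<le> N v \<omega>"
    then show "\<exists>v\<in>{r..<u}. x \<le> N v \<omega>" using rst by force
  qed
  have "?A r t = ?A r s \<union> ?A s t"
  proof (rule set_eqI)
    fix u
    show "u \<in> ?A r t \<longleftrightarrow> u \<in> ?A r s \<union> ?A s t"
      using shift[of u] rst by (cases "u \<le> s") auto
  qed
  moreover have "?A r s \<inter> ?A s t = {}" by auto
  ultimately show ?thesis
    unfolding demand_integral_def path_measure_def using rst int by (simp add: set_integral_Un)
qed

lemma demand_integral_measurable:
  assumes st: "0 \<le> s" "s \<le> t" "t \<le> T"
  shows "demand_integral f x s t \<in> borel_measurable M"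
proof (rule borel_measurable_LIMSEQ_real)
  let ?p = "grid s t"
  let ?F = "\<lambda>\<omega> u. real (N (max 0 (min T u)) \<omega>)"
  show "(\<lambda>k. \<Sum>i\<le>k. if x \<le> N (?p k i) \<omega>
      then f (?p k (Suc i)) * (?F \<omega> (?p k (Suc i)) - ?F \<omega> (?p k i)) else 0)
    \<longlonglongrightarrow> demand_integral f x s t \<omega>" if \<omega>: "\<omega> \<in> space M" for \<omega>
  proof -
    interpret stieltjes "?F \<omega>"
      using \<omega> by (rule path_stieltjes)
    show ?thesis
      unfolding demand_integral_def path_measure_def
    proof (rule riemann_stieltjes_sums[OF st(2) f_anti_sub[OF st(1,3)]])
      show "continuous (at_right u) f" if "s \<le> u" "u < t" for u
        using that st by (intro f_rc) auto
      show "x \<le> N w \<omega>" if "s \<le> v" "v \<le> w" "w \<le> t" "x \<le> N v \<omega>" for v w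
        using that st N_mono[OF \<omega>, of v w] by auto
    qed
  qed
  fix k
  show "(\<lambda>\<omega>. \<Sum>i\<le>k. if x \<le> N (?p k i) \<omega>
      then f (?p k (Suc i)) * (?F \<omega> (?p k (Suc i)) - ?F \<omega> (?p k i)) else 0) \<in> borel_measurable M"
  proof (rule borel_measurable_sum)
    fix i assume "i \<in> {..k}"
    then have "?p k i \<in> {0..T}" using grid_bounds[OF st(2), of i k] st by auto
    moreover have "max 0 (min T u) \<in> {0..T}" for u using T by auto
    ultimately have [measurable]: "N (?p k i) \<in> measurable M (count_space UNIV)"
      "N (max 0 (min T u)) \<in> measurable M (count_space UNIV)" for u
      by (auto intro: N_measurable)
    show "(\<lambda>\<omega>. if x \<le> N (?p k i) \<omega>
      then f (?p k (Suc i)) * (?F \<omega> (?p k (Suc i)) - ?F \<omega> (?p k i)) else 0) \<in> borel_measurable M"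
      by measurable
  qed
qed

lemma demand_integral_integrable:
  assumes st: "0 \<le> s" "s \<le> t" "t \<le> T"
  shows "integrable M (demand_integral f x s t)"
proof (rule Bochner_Integration.integrable_bound)
  show "integrable M (\<lambda>\<omega>. f s * (real (N t \<omega>) - real (N s \<omega>)))"
    using increment[OF st] by (auto simp: has_bochner_integral_iff)
  show "demand_integral f x s t \<in> borel_measurable M"
    using st by (rule demand_integral_measurable)
  show "AE \<omega> in M. norm (demand_integral f x s t \<omega>) \<le> norm (f s * (real (N t \<omega>) - real (N s \<omega>)))"
    unfolding real_norm_def using demand_integral_bounds(1,2)[OF _ st, of _ x]
    by (intro AE_I2) (metis abs_ge_self abs_of_nonneg order_trans)
qed

end

section \<open>Stock level and holding cost\<close>

definition stock :: "nat \<Rightarrow> real \<Rightarrow> 'a \<Rightarrow> real" where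
  "stock x t \<omega> = max 0 (real x - real (N t \<omega>))"

lemma stock_bounds: "0 \<le> stock x t \<omega>" "stock x t \<omega> \<le> real x"
  by (auto simp: stock_def)

text \<open>Each demand removes at most one unit, and an empty stock cannot fall; the second fact is
  the factor \<open>1 - of_bool (x \<le> N s \<omega>)\<close>.\<close>

lemma stock_decrease:
  assumes "\<omega> \<in> space M" "0 \<le> s" "s \<le> t" "t \<le> T"
  shows "stock x t \<omega> \<le> stock x s \<omega>"
    and "stock x s \<omega> - stock x t \<omega> \<le> (1 - of_bool (x \<le> N s \<omega>)) * (real (N t \<omega>) - real (N s \<omega>))"
  using N_mono[OF assms] by (auto simp: stock_def)

lemma stock_measurable: "t \<in> {0..T} \<Longrightarrow> stock x t \<in> borel_measurable M"
  unfolding stock_def[abs_def] using N_measurable[of t] by measurable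

lemma stock_integrable: "t \<in> {0..T} \<Longrightarrow> integrable M (stock x t)"
  using stock_bounds stock_measurable by (intro integrable_const_bound[of _ "real x"]) auto

definition holding :: "real \<Rightarrow> nat \<Rightarrow> real \<Rightarrow> 'a \<Rightarrow> real" where
  "holding \<delta> x t \<omega> = (LBINT u:{0..t}. exp (- \<delta> * u) * stock x u \<omega>)"

context
  fixes \<delta> :: real assumes \<delta>: "0 \<le> \<delta>"
begin

lemma discount_antimono: "antimono_on A (\<lambda>u. exp (- \<delta> * u))"
  using \<delta> by (auto simp: monotone_on_def intro: mult_left_mono)

lemma discounted_stock_antimono:
  "\<omega> \<in> space M \<Longrightarrow> 0 \<le> s \<Longrightarrow> t \<le> T \<Longrightarrow> antimono_on {s..t} (\<lambda>u. exp (- \<delta> * u) * stock x u \<omega>)"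
  using stock_decrease(1) stock_bounds(1)
  by (intro antimono_on_mult discount_antimono) (auto simp: monotone_on_def)

text \<open>The lower bound keeps the stock at \<open>t\<close> because the loss from discounting
  the terminal cost is proportional to the same stock, so that the two can be compared through
  \<open>c1\<close> and \<open>\<delta> * c4\<close>.\<close>

lemma holding_diff_bounds:
  assumes \<omega>: "\<omega> \<in> space M" and st: "0 \<le> s" "s \<le> t" "t \<le> T"
  shows "exp (- \<delta> * t) * stock x t \<omega> * (t - s) \<le> holding \<delta> x t \<omega> - holding \<delta> x s \<omega>"
    and "holding \<delta> x t \<omega> - holding \<delta> x s \<omega> \<le> real x * (t - s)"
proof -
  let ?g = "\<lambda>u. exp (- \<delta> * u) * stock x u \<omega>"
  note anti = discounted_stock_antimono[OF \<omega>]
  have int: "set_integrable lborel {a<..b} ?g" if "0 \<le> a" "a \<le> b" "b \<le> T" for a b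
    using identity.set_integrable_antimono[OF that(2) anti[OF that(1,3)], of "{a<..b}"]
    by (simp only: lborel_eq_real[symmetric]) simp
  have "{0<..t} = {0<..s} \<union> {s<..t}" using st by auto
  moreover have "{0<..s} \<inter> {s<..t} = {}" by auto
  ultimately have "holding \<delta> x t \<omega> = holding \<delta> x s \<omega> + (LBINT u:{s<..t}. ?g u)"
    using st int by (simp add: holding_def set_lborel_Icc_eq_Ioc set_integral_Un)
  then have diff: "holding \<delta> x t \<omega> - holding \<delta> x s \<omega> = (LINT u:{s<..t}|interval_measure (\<lambda>x. x). ?g u)"
    by (simp only: lborel_eq_real[symmetric])
  show "exp (- \<delta> * t) * stock x t \<omega> * (t - s) \<le> holding \<delta> x t \<omega> - holding \<delta> x s \<omega>"
    unfolding diff by (rule identity.set_integral_antimono_ge[OF st(2) anti[OF st(1,3)]])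
  have "holding \<delta> x t \<omega> - holding \<delta> x s \<omega> \<le> exp (- \<delta> * s) * stock x s \<omega> * (t - s)"
    unfolding diff
    by (rule identity.set_integral_antimono_le[OF st(2) anti[OF st(1,3)]]) (auto simp: stock_bounds)
  also have "\<dots> \<le> 1 * real x * (t - s)"
    using st \<delta> stock_bounds[of x s \<omega>] by (intro mult_right_mono mult_mono) auto
  finally show "holding \<delta> x t \<omega> - holding \<delta> x s \<omega> \<le> real x * (t - s)" by simp
qed

lemma holding_measurable:
  assumes t: "0 \<le> t" "t \<le> T"
  shows "holding \<delta> x t \<in> borel_measurable M"
proof (rule borel_measurable_LIMSEQ_real)
  let ?p = "grid 0 t"
  let ?g = "\<lambda>\<omega> u. exp (- \<delta> * u) * stock x u \<omega>"
  \<comment> \<open>Ordinary Riemann sums at right end points: the integrator is the identity and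
    the predicate is trivially true.\<close>
  show "(\<lambda>k. \<Sum>i\<le>k. if True then ?g \<omega> (?p k (Suc i)) * (?p k (Suc i) - ?p k i) else 0)
      \<longlonglongrightarrow> holding \<delta> x t \<omega>" if \<omega>: "\<omega> \<in> space M" for \<omega>
  proof -
    have "continuous (at_right u) (?g \<omega>)" if "0 \<le> u" "u < t" for u
      unfolding stock_def using N_right_cont[OF \<omega> that(1)] that t
      by (intro continuous_intros continuous_max) auto
    then have "(\<lambda>k. \<Sum>i\<le>k. if True then ?g \<omega> (?p k (Suc i)) * (?p k (Suc i) - ?p k i) else 0)
      \<longlonglongrightarrow> (LINT u:{u \<in> {0<..t}. \<exists>v\<in>{0..<u}. True}|interval_measure (\<lambda>x. x). ?g \<omega> u)"
      by (intro identity.riemann_stieltjes_sums[OF t(1) discounted_stock_antimono[OF \<omega> order_refl t(2)]]) auto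
    moreover have "{u \<in> {0<..t}. \<exists>v\<in>{0..<u}. True} = {0<..t}" by force
    moreover have "(LINT u:{0<..t}|interval_measure (\<lambda>x. x). ?g \<omega> u) = holding \<delta> x t \<omega>"
      by (simp only: lborel_eq_real[symmetric] holding_def set_lborel_Icc_eq_Ioc)
    ultimately show ?thesis by simp
  qed
  fix k
  have "?p k i \<in> {0..T}" if "i \<le> Suc k" for i
    using grid_bounds[OF t(1) that] t by auto
  then have "stock x (?p k (Suc i)) \<in> borel_measurable M" if "i \<in> {..k}" for i
    using that by (intro stock_measurable) auto
  then show "(\<lambda>\<omega>. \<Sum>i\<le>k. if True then ?g \<omega> (?p k (Suc i)) * (?p k (Suc i) - ?p k i) else 0)
      \<in> borel_measurable M"
    by (intro borel_measurable_sum) simp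
qed

lemma holding_integrable:
  assumes t: "0 \<le> t" "t \<le> T"
  shows "integrable M (holding \<delta> x t)"
proof (rule integrable_const_bound)
  have 0: "holding \<delta> x 0 \<omega> = 0" for \<omega>
    unfolding holding_def set_lborel_Icc_eq_Ioc by (simp add: set_lebesgue_integral_def)
  show "AE \<omega> in M. norm (holding \<delta> x t \<omega>) \<le> real x * t"
  proof (rule AE_I2)
    fix \<omega> assume \<omega>: "\<omega> \<in> space M"
    have "0 \<le> exp (- \<delta> * t) * stock x t \<omega> * (t - 0)"
      using t stock_bounds[of x t \<omega>] by auto
    then show "norm (holding \<delta> x t \<omega>) \<le> real x * t"
      using holding_diff_bounds[OF \<omega> order_refl t, of x] 0[of \<omega>] by (simp add: abs_le_iff)
  qed
qed (use holding_measurable t in auto)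

end

end

section \<open>The cost as a function of the switching time\<close>

text \<open>If \<open>\<tau> \<ge> m\<close> is a minimiser, no cost on \<open>{m..\<tau>}\<close>
  exceeds that at \<open>\<tau>\<close>, so all these times are minimisers. The minimisers form a
  non-empty compact set; its least element cannot lie beyond \<open>m\<close>, for then
  \<open>m\<close> would be a smaller minimiser.\<close>

lemma best_switching_times_mono_tail:
  fixes C :: "real \<Rightarrow> real"
  assumes cont: "continuous_on {0..T} C" and m: "m \<in> {0..T}"
    and tail: "\<And>s t. m \<le> s \<Longrightarrow> s \<le> t \<Longrightarrow> t \<le> T \<Longrightarrow> C s \<le> C t"
  defines "best \<equiv> best_switching_times T C"
  shows "(\<exists>\<tau>s\<in>best. (\<forall>\<tau>\<in>best. \<tau>s \<le> \<tau>) \<and> \<tau>s \<le> m) \<and>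
         (\<forall>\<tau>s\<in>best. \<tau>s \<le> m \<or> {m..\<tau>s} \<subseteq> best)"
proof -
  have ne: "{0..T} \<noteq> {}" using m by auto
  obtain z where z: "z \<in> {0..T}" "\<And>y. y \<in> {0..T} \<Longrightarrow> C z \<le> C y"
    using continuous_attains_inf[OF compact_Icc ne cont] by auto
  have "(INF s\<in>{0..T}. C s) = C z"
    using z by (intro cInf_eq_minimum) auto
  then have best: "best = {\<tau> \<in> {0..T}. C \<tau> = C z}"
    unfolding best_def best_switching_times_def by simp
  have below: "{m..\<tau>} \<subseteq> best" if "\<tau> \<in> best" for \<tau>
  proof
    fix s assume s: "s \<in> {m..\<tau>}"
    then have "s \<in> {0..T}" "C s \<le> C \<tau>" using that m tail[of s \<tau>] by (auto simp: best)
    then show "s \<in> best" using z(2)[of s] that by (auto simp: best)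
  qed
  have "closed best"
    unfolding best by (rule continuous_closed_preimage_constant[OF cont closed_atLeastAtMost])
  moreover have "bounded best" using bounded_closed_interval by (rule bounded_subset) (auto simp: best)
  ultimately have "compact best" by (simp add: compact_eq_bounded_closed)
  moreover have "best \<noteq> {}" using z(1) by (auto simp: best)
  ultimately obtain \<tau>s where \<tau>s: "\<tau>s \<in> best" "\<forall>\<tau>\<in>best. \<tau>s \<le> \<tau>"
    using compact_attains_inf by blast
  have "\<tau>s \<le> m"
  proof (rule ccontr)
    assume "\<not> \<tau>s \<le> m"
    then have "m \<in> best" using below[OF \<tau>s(1)] by auto
    then show False using \<tau>s(2) \<open>\<not> \<tau>s \<le> m\<close> by blast
  qed
  then show ?thesis using \<tau>s below by blast
qed

text \<open>On the reals \<open>LEAST\<close> says something only once the infimum is attained. The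
  sublevel set is closed upward, so the bound holds at all times just after the infimum, and
  right-continuity carries it to the infimum itself.\<close>

lemma sublevel_has_least:
  fixes g :: "real \<Rightarrow> real"
  assumes anti: "antimono_on {0..T} g"
    and rc: "\<And>t. 0 \<le> t \<Longrightarrow> t < T \<Longrightarrow> continuous (at_right t) g"
    and ex: "\<exists>\<tau>\<in>{0..T}. g \<tau> \<le> b"
  defines "m \<equiv> LEAST \<tau>. \<tau> \<in> {0..T} \<and> g \<tau> \<le> b"
  shows "m \<in> {0..T}" "g m \<le> b"
proof -
  define S where "S = {\<tau> \<in> {0..T}. g \<tau> \<le> b}"
  have S: "S \<noteq> {}" "bdd_below S" using ex by (auto simp: S_def intro: bdd_belowI[of _ 0])
  have lower: "Inf S \<le> t" if "t \<in> S" for t using that S(2) by (rule cInf_lower)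
  have Inf_range: "Inf S \<in> {0..T}"
    using S lower by (auto simp: S_def intro: cInf_greatest order_trans)
  have "g (Inf S) \<le> b"
  proof (cases "Inf S \<in> S")
    case False
    obtain s where "s \<in> S" using S(1) by blast
    moreover from this have "Inf S \<noteq> s" using False by blast
    ultimately have "Inf S < T" using lower[of s] by (auto simp: S_def)
    have "g t \<le> b" if t: "Inf S < t" "t < T" for t
    proof -
      obtain s where "s \<in> S" "s < t" using cInf_lessD[OF S(1) t(1)] by auto
      then have "g t \<le> g s" "g s \<le> b" using anti t by (auto simp: S_def monotone_on_def)
      then show ?thesis by linarith
    qed
    then have "\<forall>\<^sub>F t in at_right (Inf S). g t \<le> b"
      using \<open>Inf S < T\<close> unfolding eventually_at_right_field by auto
    moreover have "(g \<longlongrightarrow> g (Inf S)) (at_right (Inf S))"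
      using rc[of "Inf S"] Inf_range \<open>Inf S < T\<close> by (simp add: continuous_within)
    ultimately show ?thesis by (intro tendsto_upperbound) auto
  qed (simp add: S_def)
  moreover have "m = Inf S"
    unfolding m_def using calculation Inf_range lower by (intro Least_equality) (auto simp: S_def)
  ultimately show "m \<in> {0..T}" "g m \<le> b" using Inf_range by auto
qed

lemma exp_minus_diff_le:
  fixes \<delta> s t :: real
  assumes "0 \<le> \<delta>" "0 \<le> s" "s \<le> t"
  shows "exp (- \<delta> * s) - exp (- \<delta> * t) \<le> \<delta> * (t - s) * exp (- \<delta> * s)"
    and "exp (- \<delta> * s) - exp (- \<delta> * t) \<le> \<delta> * (t - s)"
    and "exp (- \<delta> * t) \<le> exp (- \<delta> * s)"
proof -
  have "1 - \<delta> * (t - s) \<le> exp (- \<delta> * (t - s))"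
    using exp_ge_add_one_self[of "- \<delta> * (t - s)"] by simp
  then have "exp (- \<delta> * s) * (1 - \<delta> * (t - s)) \<le> exp (- \<delta> * s) * exp (- \<delta> * (t - s))"
    by (intro mult_left_mono) auto
  also have "\<dots> = exp (- \<delta> * t)"
    unfolding exp_add[symmetric] by (simp add: algebra_simps)
  finally show 1: "exp (- \<delta> * s) - exp (- \<delta> * t) \<le> \<delta> * (t - s) * exp (- \<delta> * s)"
    by (simp add: algebra_simps)
  also have "\<dots> \<le> \<delta> * (t - s) * 1" using assms by (intro mult_left_mono) auto
  finally show "exp (- \<delta> * s) - exp (- \<delta> * t) \<le> \<delta> * (t - s)" by simp
  show "exp (- \<delta> * t) \<le> exp (- \<delta> * s)" using assms by (simp add: mult_left_mono)
qed

section \<open>The switching problem and its pathwise cost\<close>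

locale switching_problem = poisson_demand M N lam T
  for M :: "'a measure" and N lam and T :: real +
  fixes c2 c3 :: "real \<Rightarrow> real" and \<delta> c1 c4 :: real and x :: nat
  assumes c1: "0 \<le> c1" and \<delta>: "0 \<le> \<delta>"
    and c3_regular: "regular_nonincreasing T c3"
    and c23_regular: "regular_nonincreasing T (\<lambda>u. c2 u - c3 u)"
    and c3_nonneg: "\<And>t. t \<in> {0..T} \<Longrightarrow> 0 \<le> c3 t"
    and c23_nonneg: "\<And>t. t \<in> {0..T} \<Longrightarrow> 0 \<le> c2 t - c3 t"
    and c4: "0 \<le> c4" and c14: "0 \<le> c1 - \<delta> * c4"
begin

lemma c2_nonneg: "t \<in> {0..T} \<Longrightarrow> 0 \<le> c2 t"
  using c3_nonneg[of t] c23_nonneg[of t] by linarith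

lemma c2_antimono: "antimono_on {0..T} c2"
  unfolding monotone_on_def
proof (intro ballI impI)
  fix s t assume "s \<in> {0..T}" "t \<in> {0..T}" "s \<le> t"
  then have "c3 t \<le> c3 s" "c2 t - c3 t \<le> c2 s - c3 s"
    using regular_nonincreasingD(1)[OF c3_regular] regular_nonincreasingD(1)[OF c23_regular]
    by (auto simp: monotone_on_def)
  then show "c2 t \<le> c2 s" by linarith
qed

lemma c2_right_cont: "0 \<le> t \<Longrightarrow> t < T \<Longrightarrow> continuous (at_right t) c2"
  using continuous_add[OF regular_nonincreasingD(2)[OF c3_regular] regular_nonincreasingD(2)[OF c23_regular]]
  by simp

definition f2 :: "real \<Rightarrow> real" where "f2 u = exp (- \<delta> * u) * c2 u"
definition f3 :: "real \<Rightarrow> real" where "f3 u = exp (- \<delta> * u) * c3 u"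

lemma f2: "antimono_on {0..T} f2" "0 \<le> t \<Longrightarrow> t < T \<Longrightarrow> continuous (at_right t) f2"
    "t \<in> {0..T} \<Longrightarrow> 0 \<le> f2 t"
  using antimono_on_mult[OF discount_antimono[OF \<delta>] c2_antimono] c2_nonneg c2_right_cont[of t]
  unfolding f2_def[abs_def] by (auto intro!: continuous_intros)

lemma f3: "antimono_on {0..T} f3" "0 \<le> t \<Longrightarrow> t < T \<Longrightarrow> continuous (at_right t) f3"
    "t \<in> {0..T} \<Longrightarrow> 0 \<le> f3 t"
  using antimono_on_mult[OF discount_antimono[OF \<delta>] regular_nonincreasingD(1)[OF c3_regular]]
    c3_nonneg regular_nonincreasingD(2)[OF c3_regular, of t]
  unfolding f3_def[abs_def] by (auto intro!: continuous_intros)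

definition path_cost :: "real \<Rightarrow> 'a \<Rightarrow> real" where
  "path_cost \<tau> \<omega> = c1 * holding \<delta> x \<tau> \<omega> + demand_integral f2 x 0 \<tau> \<omega>
     + demand_integral f3 0 \<tau> T \<omega> + c4 * exp (- \<delta> * \<tau>) * stock x \<tau> \<omega>"

text \<open>To lie strictly after an infimum of times is to lie strictly after one of these times;
  this removes the depletion time from the integral and leaves a condition on the path before
  \<open>u\<close>.\<close>

lemma charged_interval:
  assumes \<omega>: "\<omega> \<in> space M" and \<tau>: "0 \<le> \<tau>" "\<tau> \<le> T"
  shows "{min_depletion T N x \<tau> \<omega><..\<tau>} = {u \<in> {0<..\<tau>}. \<exists>v\<in>{0..<u}. x \<le> N v \<omega>}"
proof -
  let ?D = "depletion_time T N x \<omega>"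
  have "0 \<le> ?D" unfolding depletion_time_def by (rule Inf_greatest) auto
  then obtain r where r: "min (ereal \<tau>) ?D = ereal r" "0 \<le> r"
    using \<tau>(1) by (cases "min (ereal \<tau>) ?D") (auto simp: min_def split: if_splits)
  have "?D < ereal u \<longleftrightarrow> (\<exists>v>0. v \<le> T \<and> v < u \<and> x \<le> N v \<omega>)" for u
    unfolding depletion_time_def Inf_less_iff by auto
  then have r_less: "r < u \<longleftrightarrow> \<tau> < u \<or> (\<exists>v>0. v \<le> T \<and> v < u \<and> x \<le> N v \<omega>)" for u
    using min_less_iff_disj[of "ereal \<tau>" ?D "ereal u"] r(1) by simp
  have "r < u \<and> u \<le> \<tau> \<longleftrightarrow> (0 < u \<and> u \<le> \<tau>) \<and> (\<exists>v\<in>{0..<u}. x \<le> N v \<omega>)" for u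
  proof (intro iffI conjI; elim conjE)
    assume u: "r < u" "u \<le> \<tau>"
    then show "0 < u" "u \<le> \<tau>" using r(2) by auto
    show "\<exists>v\<in>{0..<u}. x \<le> N v \<omega>" using u r_less[of u] by force
  next
    assume u: "0 < u" "u \<le> \<tau>" and "\<exists>v\<in>{0..<u}. x \<le> N v \<omega>"
    then obtain v where v: "0 \<le> v" "v < u" "x \<le> N v \<omega>" by auto
    \<comment> \<open>The depletion time ranges over positive times only, whereas for
      \<open>x = 0\<close> the witness \<open>v\<close> may be 0; \<open>u / 2\<close> is positive
      and still before \<open>u\<close>.\<close>
    have "N v \<omega> \<le> N (max v (u / 2)) \<omega>" using v u \<tau> by (intro N_mono[OF \<omega>]) auto
    then show "r < u"
      unfolding r_less using v u \<tau> by (intro disjI2 exI[of _ "max v (u / 2)"]) auto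
  qed
  moreover have "min_depletion T N x \<tau> \<omega> = r" unfolding min_depletion_def r(1) by simp
  ultimately show ?thesis unfolding set_eq_iff greaterThanAtMost_iff mem_Collect_eq by blast
qed

lemma path_cost_integrable: "\<tau> \<in> {0..T} \<Longrightarrow> integrable M (path_cost \<tau>)"
  unfolding path_cost_def[abs_def] using T
  by (intro Bochner_Integration.integrable_add integrable_mult_right
      demand_integral_integrable f2 f3 holding_integrable[OF \<delta>] stock_integrable) auto

lemma switching_cost_eq:
  assumes \<tau>: "\<tau> \<in> {0..T}"
  shows "switching_cost M T N \<delta> c1 c2 c3 c4 x \<tau> = expectation (path_cost \<tau>)"
proof -
  have full: "{u \<in> {\<tau><..T}. \<exists>v\<in>{\<tau>..<u}. 0 \<le> N v \<omega>} = {\<tau><..T}" for \<omega>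
    by force
  have "(LINT \<omega>|M. (LINT u:{min_depletion T N x \<tau> \<omega><..\<tau>}|path_measure T N \<omega>. exp (- \<delta> * u) * c2 u))
      = (LINT \<omega>|M. demand_integral f2 x 0 \<tau> \<omega>)"
    using \<tau> by (intro Bochner_Integration.integral_cong) (auto simp: demand_integral_def f2_def charged_interval)
  moreover have "(LINT \<omega>|M. (LINT u:{\<tau><..T}|path_measure T N \<omega>. exp (- \<delta> * u) * c3 u))
      = (LINT \<omega>|M. demand_integral f3 0 \<tau> T \<omega>)"
    unfolding demand_integral_def full f3_def ..
  moreover have "(LINT \<omega>|M. (LBINT u:{0..\<tau>}. exp (- \<delta> * u) * max 0 (real x - real (N u \<omega>))))
      = (LINT \<omega>|M. holding \<delta> x \<tau> \<omega>)"
    unfolding holding_def stock_def ..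
  moreover have int: "integrable M (holding \<delta> x \<tau>)" "integrable M (stock x \<tau>)"
    "integrable M (demand_integral f2 x 0 \<tau>)" "integrable M (demand_integral f3 0 \<tau> T)"
    using \<tau> T by (auto intro: demand_integral_integrable f2 f3 holding_integrable[OF \<delta>] stock_integrable)
  ultimately show ?thesis
    unfolding path_cost_def[abs_def] switching_cost_def
    by (simp add: stock_def[symmetric])
qed

text \<open>The second-order error in comparing \<open>c1\<close> with \<open>\<delta> * c4\<close> at different discount factors.\<close>

definition \<kappa> :: real where "\<kappa> = c4 * \<delta> * \<delta> * real x"

text \<open>Postponing the switch adds holding cost \<open>I\<close> and charges \<open>J\<close>,
  saves \<open>K\<close>, and lowers the terminal cost in two ways. The fall of the discount factor
  is covered by \<open>I\<close>, since \<open>\<delta> * c4 \<le> c1\<close>, up to second order in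
  time. The fall of the stock is at most \<open>D\<close>, and is zero if the stock is empty at
  \<open>s\<close>.\<close>

lemma path_cost_increment:
  fixes s t :: real and \<omega> :: 'a
  assumes \<omega>: "\<omega> \<in> space M" and st: "0 \<le> s" "s \<le> t" "t \<le> T"
  defines "D \<equiv> real (N t \<omega>) - real (N s \<omega>)"
  shows "of_bool (x \<le> N s \<omega>) * D * (f2 t + c4 * exp (- \<delta> * s)) - D * (f3 s + c4 * exp (- \<delta> * s))
      - \<kappa> * (t - s)\<^sup>2 \<le> path_cost t \<omega> - path_cost s \<omega>" (is ?lower)
    and "\<bar>path_cost t \<omega> - path_cost s \<omega>\<bar> \<le> (c1 + c4 * \<delta>) * real x * (t - s) + (c2 0 + c3 0 + c4) * D" (is ?abs)
proof -
  let ?b = "of_bool (x \<le> N s \<omega>) :: real"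
  define h where "h = t - s"
  define es et rs rt where "es = exp (- \<delta> * s)" "et = exp (- \<delta> * t)" "rs = stock x s \<omega>" "rt = stock x t \<omega>"
  define I J K where "I = holding \<delta> x t \<omega> - holding \<delta> x s \<omega>"
    "J = demand_integral f2 x s t \<omega>" "K = demand_integral f3 0 s t \<omega>"
  have h: "0 \<le> h" using st by (simp add: h_def)
  have D: "0 \<le> D" using N_mono[OF \<omega> st] by (simp add: D_def)
  have e: "es - et \<le> \<delta> * h * es" "es - et \<le> \<delta> * h" "et \<le> es" "0 < et" "es \<le> 1"
    using exp_minus_diff_le[OF \<delta> st(1,2)] \<delta> st by (auto simp: es_et_rs_rt_def h_def)
  have r: "0 \<le> rt" "rt \<le> real x" "rt \<le> rs" "rs - rt \<le> (1 - ?b) * D" "rs \<le> real x"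
    using stock_bounds stock_decrease[OF \<omega> st] by (auto simp: es_et_rs_rt_def D_def)
  have I: "et * rt * h \<le> I" "I \<le> real x * h"
    using holding_diff_bounds[OF \<delta> \<omega> st] by (auto simp: I_J_K_def es_et_rs_rt_def h_def)
  have J: "0 \<le> J" "J \<le> f2 s * D"  "?b * D * f2 t \<le> J"
    using demand_integral_bounds[OF f2 \<omega> st] by (auto simp: I_J_K_def D_def mult.commute)
  have K: "0 \<le> K" "K \<le> f3 s * D"
    using demand_integral_bounds[OF f3 \<omega> st] by (auto simp: I_J_K_def D_def)
  have diff: "path_cost t \<omega> - path_cost s \<omega> = c1 * I + J - K + c4 * (et * rt - es * rs)"
    unfolding path_cost_def
    using demand_integral_add[OF f2 \<omega> order_refl st, of x]
      demand_integral_add[OF f3 \<omega> st order_refl, of 0]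
    by (simp add: I_J_K_def es_et_rs_rt_def algebra_simps)
  \<comment> \<open>The holding bound carries the discount factor at \<open>t\<close>, so
    \<open>es\<close> is replaced by \<open>et + \<delta> * h\<close>. The excess, at most
    \<open>(\<delta> * h)^2 * real x\<close>, is the source of \<open>\<kappa>\<close>.\<close>
  have "(es - et) * rt \<le> \<delta> * h * es * rt" using e(1) r(1) by (rule mult_right_mono)
  also have "\<dots> \<le> \<delta> * h * (et + \<delta> * h) * rt"
    using e(2) r(1) \<delta> h by (intro mult_right_mono mult_left_mono) auto
  also have "\<dots> = \<delta> * h * et * rt + (\<delta> * h)\<^sup>2 * rt" by (simp add: algebra_simps power2_eq_square)
  also have "\<dots> \<le> \<delta> * h * et * rt + (\<delta> * h)\<^sup>2 * real x"
    using r(2) by (intro add_left_mono mult_left_mono) auto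
  finally have "c4 * ((es - et) * rt) \<le> c4 * (\<delta> * h * et * rt + (\<delta> * h)\<^sup>2 * real x)"
    using c4 by (rule mult_left_mono)
  then have 1: "c4 * ((es - et) * rt) \<le> \<delta> * c4 * (et * rt * h) + \<kappa> * h\<^sup>2"
    by (simp add: \<kappa>_def algebra_simps power2_eq_square)
  have 2: "c4 * (es * (rs - rt)) \<le> c4 * (es * ((1 - ?b) * D))"
    using r(4) e(3,4) c4 by (intro mult_left_mono) auto
  have "0 \<le> (c1 - \<delta> * c4) * (et * rt * h)"
    using c14 e(4) r(1) h by (intro mult_nonneg_nonneg) auto
  moreover have "c1 * (et * rt * h) \<le> c1 * I" using I(1) c1 by (rule mult_left_mono)
  ultimately have 3: "\<delta> * c4 * (et * rt * h) \<le> c1 * I" by (simp add: algebra_simps)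
  have 4: "c4 * (et * rt - es * rs) = - (c4 * ((es - et) * rt)) - c4 * (es * (rs - rt))"
    by (simp add: algebra_simps)
  have "?b * D * f2 t - f3 s * D - c4 * (es * ((1 - ?b) * D)) - \<kappa> * h\<^sup>2
      \<le> path_cost t \<omega> - path_cost s \<omega>"
    unfolding diff 4 using 1 2 3 J(3) K(2) by linarith
  then show ?lower
    unfolding h_def es_et_rs_rt_def by (simp add: algebra_simps)
  have 5: "0 \<le> c1 * I" "c1 * I \<le> c1 * (real x * h)"
  proof -
    have "0 \<le> et * rt * h" using e(4) r(1) h by simp
    then show "0 \<le> c1 * I" using I(1) c1 by simp
    show "c1 * I \<le> c1 * (real x * h)" using I(2) c1 by (rule mult_left_mono)
  qed
  have "f2 s \<le> f2 0" "f3 s \<le> f3 0"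
    using f2(1) f3(1) st unfolding monotone_on_def by auto
  then have "f2 s * D \<le> c2 0 * D" "f3 s * D \<le> c3 0 * D"
    using D by (auto simp: f2_def f3_def intro!: mult_right_mono)
  moreover have "0 \<le> c2 0 * D" "0 \<le> c3 0 * D"
    using c2_nonneg[of 0] c3_nonneg[of 0] D T by auto
  ultimately have 6: "\<bar>J - K\<bar> \<le> c2 0 * D + c3 0 * D" using J(1,2) K by linarith
  have "(es - et) * rt \<le> \<delta> * h * real x"
    using e(2,3) r(1,2) \<delta> h by (intro mult_mono) auto
  moreover have "es * (rs - rt) \<le> 1 * D"
  proof (rule mult_mono)
    have "(1 - ?b) * D \<le> 1 * D" using D by (intro mult_right_mono) auto
    then show "rs - rt \<le> D" using r(4) by simp
  qed (use e r in auto)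
  ultimately have "c4 * ((es - et) * rt) \<le> c4 * (\<delta> * h * real x)" "c4 * (es * (rs - rt)) \<le> c4 * D"
    using c4 by (auto intro: mult_left_mono)
  moreover have "0 \<le> c4 * ((es - et) * rt)" "0 \<le> c4 * (es * (rs - rt))"
    using c4 e(3,4) r(1,3) by auto
  ultimately have 7: "\<bar>c4 * (et * rt - es * rs)\<bar> \<le> c4 * (\<delta> * h * real x) + c4 * D"
    unfolding 4 by linarith
  have "\<bar>path_cost t \<omega> - path_cost s \<omega>\<bar>
      \<le> c1 * (real x * h) + (c2 0 * D + c3 0 * D) + (c4 * (\<delta> * h * real x) + c4 * D)"
    unfolding diff using 5 6 7 by linarith
  also have "\<dots> = (c1 + c4 * \<delta>) * real x * (t - s) + (c2 0 + c3 0 + c4) * D"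
    by (simp add: h_def algebra_simps)
  finally show ?abs .
qed

section \<open>Probability of depletion and the inequality for the bound\<close>

definition p :: "real \<Rightarrow> real" where
  "p t = prob {\<omega> \<in> space M. x \<le> N t \<omega>}"

text \<open>Reaching the level between \<open>s\<close> and \<open>t\<close> takes at least one
  demand, so the difference of the two indicators is at most the increment of
  \<open>N\<close>.\<close>

lemma p_increment:
  assumes st: "0 \<le> s" "s \<le> t" "t \<le> T"
  shows "p s \<le> p t" "p t - p s \<le> mean s t"
proof -
  have "N s \<in> measurable M (count_space UNIV)" "N t \<in> measurable M (count_space UNIV)"
    using st by (auto intro: N_measurable)
  then have ev: "{\<omega> \<in> space M. x \<le> N s \<omega>} \<in> events" "{\<omega> \<in> space M. x \<le> N t \<omega>} \<in> events"
    by measurable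
  show "p s \<le> p t"
    unfolding p_def using ev N_mono[OF _ st] by (intro finite_measure_mono) (auto intro: order_trans)
  have "p t - p s = expectation (\<lambda>\<omega>. indicator {\<omega> \<in> space M. x \<le> N t \<omega>} \<omega> - indicator {\<omega> \<in> space M. x \<le> N s \<omega>} \<omega>)"
    using ev unfolding p_def by (subst Bochner_Integration.integral_diff) (auto simp: emeasure_eq_measure)
  also have "\<dots> \<le> expectation (\<lambda>\<omega>. real (N t \<omega>) - real (N s \<omega>))"
  proof (rule integral_mono)
    show "integrable M (\<lambda>\<omega>. indicator {\<omega> \<in> space M. x \<le> N t \<omega>} \<omega> - indicator {\<omega> \<in> space M. x \<le> N s \<omega>} \<omega> :: real)"
      using ev by (intro Bochner_Integration.integrable_diff) (auto simp: emeasure_eq_measure)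
    show "integrable M (\<lambda>\<omega>. real (N t \<omega>) - real (N s \<omega>))"
      using increment[OF st] by (simp add: has_bochner_integral_iff)
    show "indicator {\<omega> \<in> space M. x \<le> N t \<omega>} \<omega> - indicator {\<omega> \<in> space M. x \<le> N s \<omega>} \<omega>
      \<le> real (N t \<omega>) - real (N s \<omega>)" if "\<omega> \<in> space M" for \<omega>
      using N_mono[OF that st] by (auto simp: indicator_def)
  qed
  also have "\<dots> = mean s t" using increment[OF st] by (simp add: has_bochner_integral_iff)
  finally show "p t - p s \<le> mean s t" .
qed

lemma ub_condition_iff:
  assumes "\<tau> \<in> {0..T}"
  shows "ub_condition M T N c2 c3 c4 x \<tau> \<longleftrightarrow> (1 - p \<tau>) * (c2 \<tau> + c4) \<le> c2 T - c3 T"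
proof -
  have "N \<tau> \<in> measurable M (count_space UNIV)" using assms by (rule N_measurable)
  then have "{\<omega> \<in> space M. x \<le> N \<tau> \<omega>} \<in> events" by measurable
  moreover have "{\<omega> \<in> space M. int (N \<tau> \<omega>) \<le> int x - 1} = space M - {\<omega> \<in> space M. x \<le> N \<tau> \<omega>}"
    by auto
  ultimately show ?thesis unfolding ub_condition_def p_def by (simp add: prob_compl)
qed

text \<open>Right-continuity is what makes a least solution of the inequality exist. For
  \<open>p\<close> it comes from squeezing \<open>p u\<close> between \<open>p t\<close> and
  \<open>p t + lam 0 * (u - t)\<close>.\<close>

lemma ub_product:
  shows "antimono_on {0..T} (\<lambda>\<tau>. (1 - p \<tau>) * (c2 \<tau> + c4))"
    and "0 \<le> t \<Longrightarrow> t < T \<Longrightarrow> continuous (at_right t) (\<lambda>\<tau>. (1 - p \<tau>) * (c2 \<tau> + c4))"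
proof -
  have "antimono_on {0..T} (\<lambda>\<tau>. 1 - p \<tau>)" "antimono_on {0..T} (\<lambda>\<tau>. c2 \<tau> + c4)"
    using p_increment(1) c2_antimono unfolding monotone_on_def by auto
  then show "antimono_on {0..T} (\<lambda>\<tau>. (1 - p \<tau>) * (c2 \<tau> + c4))"
    by (rule antimono_on_mult) (use c2_nonneg c4 in \<open>auto simp: p_def\<close>)
  assume t: "0 \<le> t" "t < T"
  have "(p \<longlongrightarrow> p t) (at_right t)"
  proof (rule tendsto_sandwich)
    have ev: "\<forall>\<^sub>F u in at_right t. t < u \<and> u < T"
      using t unfolding eventually_at_right_field by auto
    show "\<forall>\<^sub>F u in at_right t. p t \<le> p u"
      using ev by eventually_elim (use t in \<open>auto intro: p_increment\<close>)
    show "\<forall>\<^sub>F u in at_right t. p u \<le> p t + lam 0 * (u - t)"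
      using ev
    proof eventually_elim
      case (elim u)
      then show ?case using p_increment(2)[of t u] mean_bounds(2)[of t u] t by linarith
    qed
    have "((\<lambda>u. p t + lam 0 * (u - t)) \<longlongrightarrow> p t + lam 0 * (t - t)) (at_right t)"
      by (intro tendsto_intros)
    then show "((\<lambda>u. p t + lam 0 * (u - t)) \<longlongrightarrow> p t) (at_right t)" by simp
  qed simp
  then show "continuous (at_right t) (\<lambda>\<tau>. (1 - p \<tau>) * (c2 \<tau> + c4))"
    using c2_right_cont[OF t] unfolding continuous_within by (intro tendsto_intros)
qed

section \<open>Regularity and monotonicity of the expected cost\<close>

abbreviation "C \<equiv> switching_cost M T N \<delta> c1 c2 c3 c4 x"

lemma cost_increment_eq:
  assumes "0 \<le> s" "s \<le> t" "t \<le> T"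
  shows "C t - C s = expectation (\<lambda>\<omega>. path_cost t \<omega> - path_cost s \<omega>)"
  using assms by (simp add: switching_cost_eq path_cost_integrable)

lemma cost_lipschitz:
  assumes st: "0 \<le> s" "s \<le> t" "t \<le> T"
  shows "\<bar>C t - C s\<bar> \<le> ((c1 + c4 * \<delta>) * real x + (c2 0 + c3 0 + c4) * lam 0) * (t - s)"
proof -
  have int: "integrable M (path_cost s)" "integrable M (path_cost t)"
    using st by (auto intro: path_cost_integrable)
  have incr: "has_bochner_integral M (\<lambda>\<omega>. (c1 + c4 * \<delta>) * real x * (t - s)
      + (c2 0 + c3 0 + c4) * (real (N t \<omega>) - real (N s \<omega>)))
      ((c1 + c4 * \<delta>) * real x * (t - s) + (c2 0 + c3 0 + c4) * mean s t)"
    using increment[OF st] by (auto simp: has_bochner_integral_iff prob_space)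
  have "\<bar>C t - C s\<bar> \<le> expectation (\<lambda>\<omega>. \<bar>path_cost t \<omega> - path_cost s \<omega>\<bar>)"
    unfolding cost_increment_eq[OF st] by (rule integral_abs_bound)
  also have "\<dots> \<le> expectation (\<lambda>\<omega>. (c1 + c4 * \<delta>) * real x * (t - s)
      + (c2 0 + c3 0 + c4) * (real (N t \<omega>) - real (N s \<omega>)))"
    using int incr path_cost_increment(2)[OF _ st]
    by (intro integral_mono) (auto simp: has_bochner_integral_iff)
  also have "\<dots> = (c1 + c4 * \<delta>) * real x * (t - s) + (c2 0 + c3 0 + c4) * mean s t"
    using incr by (rule has_bochner_integral_integral_eq)
  also have "\<dots> \<le> (c1 + c4 * \<delta>) * real x * (t - s) + (c2 0 + c3 0 + c4) * (lam 0 * (t - s))"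
    using mean_bounds[OF st] c2_nonneg[of 0] c3_nonneg[of 0] c4 T
    by (intro add_left_mono mult_left_mono) auto
  finally show ?thesis by (simp add: algebra_simps)
qed

lemma cost_continuous: "continuous_on {0..T} C"
proof -
  let ?L = "(c1 + c4 * \<delta>) * real x + (c2 0 + c3 0 + c4) * lam 0"
  have "0 \<le> ?L"
    using c1 c4 \<delta> c2_nonneg[of 0] c3_nonneg[of 0] lam_nonneg[of 0] T by auto
  moreover have "dist (C s) (C t) \<le> ?L * dist s t" if "s \<in> {0..T}" "t \<in> {0..T}" for s t
    using cost_lipschitz[of s t] cost_lipschitz[of t s] that
    by (cases "s \<le> t") (auto simp: dist_real_def abs_minus_commute)
  ultimately have "?L-lipschitz_on {0..T} C" by (intro lipschitz_onI)
  then show ?thesis by (rule lipschitz_on_continuous_on)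
qed

text \<open>Once \<open>f2 t\<close> is replaced by \<open>f2 s\<close>, the coefficient of
  \<open>mean s t\<close> becomes \<open>e * (c2 s - c3 s - (1 - p s) * (c2 s + c4))\<close>. It is
  non-negative by the inequality at \<open>s\<close>, because \<open>c2 - c3\<close> is at least its
  value at \<open>T\<close>. The replacement costs \<open>p s * (f2 s - f2 t)\<close> per unit of
  mean, which is the part of the error that sees the jumps of \<open>c2\<close>.\<close>

lemma cost_increase:
  assumes st: "0 \<le> s" "s \<le> t" "t \<le> T" and ub: "(1 - p s) * (c2 s + c4) \<le> c2 T - c3 T"
  shows "C s - (\<kappa> + lam 0) * (t - s) * ((t - s) + (f2 s - f2 t)) \<le> C t"
proof -
  define e where "e = exp (- \<delta> * s)"
  let ?b = "\<lambda>\<omega>. of_bool (x \<le> N s \<omega>) * (real (N t \<omega>) - real (N s \<omega>))"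
  let ?D = "\<lambda>\<omega>. real (N t \<omega>) - real (N s \<omega>)"
  have int: "integrable M (path_cost s)" "integrable M (path_cost t)"
    using st by (auto intro: path_cost_integrable)
  have p: "0 \<le> p s" "p s \<le> 1" by (auto simp: p_def)
  have lower: "has_bochner_integral M
      (\<lambda>\<omega>. ?b \<omega> * (f2 t + c4 * e) - ?D \<omega> * (f3 s + c4 * e) - \<kappa> * (t - s)\<^sup>2)
      (p s * mean s t * (f2 t + c4 * e) - mean s t * (f3 s + c4 * e) - \<kappa> * (t - s)\<^sup>2)"
    using increment[OF st] increment_indep[OF st, of x]
    by (auto simp: has_bochner_integral_iff prob_space p_def)
  have "p s * mean s t * (f2 t + c4 * e) - mean s t * (f3 s + c4 * e) - \<kappa> * (t - s)\<^sup>2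
      = expectation (\<lambda>\<omega>. ?b \<omega> * (f2 t + c4 * e) - ?D \<omega> * (f3 s + c4 * e) - \<kappa> * (t - s)\<^sup>2)"
    using lower by (rule has_bochner_integral_integral_eq[symmetric])
  also have "\<dots> \<le> C t - C s"
    unfolding cost_increment_eq[OF st] using int lower path_cost_increment(1)[OF _ st]
    by (intro integral_mono) (auto simp: has_bochner_integral_iff e_def)
  finally have 1: "mean s t * (p s * f2 t - f3 s - (1 - p s) * (c4 * e)) - \<kappa> * (t - s)\<^sup>2 \<le> C t - C s"
    by (simp add: algebra_simps)
  have "c2 T - c3 T \<le> c2 s - c3 s"
    using regular_nonincreasingD(1)[OF c23_regular] st by (auto simp: monotone_on_def)
  with ub have "0 \<le> e * (c2 s - c3 s - (1 - p s) * (c2 s + c4))" by (simp add: e_def)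
  then have "0 \<le> mean s t * (p s * f2 s - f3 s - (1 - p s) * (c4 * e))"
    using mean_bounds(1)[OF st] by (intro mult_nonneg_nonneg) (auto simp: f2_def f3_def e_def algebra_simps)
  moreover have "f2 t \<le> f2 s" using f2(1) st by (auto simp: monotone_on_def)
  then have 2: "mean s t * (p s * (f2 s - f2 t)) \<le> lam 0 * (t - s) * (1 * (f2 s - f2 t))"
    using mean_bounds[OF st] p by (intro mult_mono) auto
  ultimately have "- \<kappa> * (t - s)\<^sup>2 - lam 0 * (t - s) * (f2 s - f2 t) \<le> C t - C s"
    using 1 by (simp add: algebra_simps)
  \<comment> \<open>The two cross terms are non-negative and are added only to bring both errors
    into product form with the single constant \<open>\<kappa> + lam 0\<close>.\<close>
  moreover have "0 \<le> \<kappa> * (t - s) * (f2 s - f2 t)"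
    using \<open>f2 t \<le> f2 s\<close> st c4 \<delta> unfolding \<kappa>_def by (intro mult_nonneg_nonneg) auto
  moreover have "0 \<le> lam 0 * (t - s)\<^sup>2" using lam_nonneg[of 0] T by simp
  ultimately show ?thesis by (simp add: algebra_simps power2_eq_square)
qed

lemma cost_mono_after_tau_ub:
  defines "m \<equiv> tau_ub M T N c2 c3 c4 x"
  shows "m \<in> {0..T}" and "m \<le> s \<Longrightarrow> s \<le> t \<Longrightarrow> t \<le> T \<Longrightarrow> C s \<le> C t"
proof -
  let ?g = "\<lambda>\<tau>. (1 - p \<tau>) * (c2 \<tau> + c4)" and ?ub = "ub_condition M T N c2 c3 c4 x"
  have *: "m \<in> {0..T} \<and> (m = T \<or> ?g m \<le> c2 T - c3 T)"
  proof (cases "\<exists>\<tau>\<in>{0..T}. ?ub \<tau>")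
    case True
    then have "m = (LEAST \<tau>. \<tau> \<in> {0..T} \<and> ?ub \<tau>)" by (simp add: m_def tau_ub_def)
    also have "\<dots> = (LEAST \<tau>. \<tau> \<in> {0..T} \<and> ?g \<tau> \<le> c2 T - c3 T)"
      using ub_condition_iff by (intro arg_cong[of _ _ Least] ext) blast
    finally show ?thesis
      using sublevel_has_least[OF ub_product, of "c2 T - c3 T"] True ub_condition_iff by blast
  qed (use T in \<open>auto simp: m_def tau_ub_def\<close>)
  then show m: "m \<in> {0..T}" by blast
  have ub: "m = T \<or> ?g m \<le> c2 T - c3 T" using * by blast
  assume st: "m \<le> s" "s \<le> t" "t \<le> T"
  \<comment> \<open>\<open>m = T\<close> includes the default value of \<open>tau_ub\<close>, where
    the inequality may fail; the tail is then a single point.\<close>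
  show "C s \<le> C t"
  proof (cases "m = T")
    case False
    show ?thesis
    proof (rule le_of_small_increments[OF st(2)])
      fix u v assume uv: "s \<le> u" "u \<le> v" "v \<le> t"
      have "?g u \<le> ?g m" using ub_product(1) m uv st unfolding monotone_on_def by auto
      then show "C u - (\<kappa> + lam 0) * (v - u) * ((v - u) + (f2 u - f2 v)) \<le> C v"
        using False ub m uv st by (intro cost_increase) auto
    qed
  next
    case True
    then have "s = t" using st by linarith
    then show ?thesis by simp
  qed
qed

end

theorem proposition3p5:
  fixes M :: "'a measure" and N :: "real \<Rightarrow> 'a \<Rightarrow> nat"
    and lam c2 c3 :: "real \<Rightarrow> real" and T \<delta> c1 c4 :: real and x :: nat
  defines "best \<equiv> best_switching_times T (switching_cost M T N \<delta> c1 c2 c3 c4 x)"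
    and "\<tau>ub \<equiv> tau_ub M T N c2 c3 c4 x"
  assumes T: "0 \<le> T"
    and lam_nonneg: "\<forall>t\<in>{0..T}. 0 \<le> lam t"
    and lam_regular: "regular_nonincreasing T lam"
    and N: "nonhom_poisson_process M T lam N"
    and c1: "0 \<le> c1"
    and delta: "0 \<le> \<delta>" "\<delta> \<le> 1"
    and c2_nonneg: "\<forall>t\<in>{0..T}. 0 \<le> c2 t"
    and NON_INC: "regular_nonincreasing T c3" "regular_nonincreasing T (\<lambda>u. c2 u - c3 u)"
    and POS: "\<forall>t\<in>{0..T}. 0 \<le> c3 t" "\<forall>t\<in>{0..T}. 0 \<le> c2 t - c3 t" "0 \<le> c4" "0 \<le> c1 - \<delta> * c4"
  shows "(\<exists>\<tau>s\<in>best. (\<forall>\<tau>\<in>best. \<tau>s \<le> \<tau>) \<and> \<tau>s \<le> \<tau>ub) \<and>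
         (\<forall>\<tau>s\<in>best. \<tau>s \<le> \<tau>ub \<or> {\<tau>ub..\<tau>s} \<subseteq> best)"
proof -
  interpret prob_space M
    using N by (simp add: nonhom_poisson_process_def)
  interpret switching_problem M N lam T c2 c3 \<delta> c1 c4 x
    using assms regular_nonincreasingD(1)[OF lam_regular] by unfold_locales auto
  show ?thesis
    unfolding best_def \<tau>ub_def
    using cost_continuous cost_mono_after_tau_ub by (rule best_switching_times_mono_tail)
qed

end
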